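(* Let $D$ be a Platonic surface with Schläfli symbol $\{p,q\}$. Define $k'$ to be the smallest positive integer satisfying $$k'\,\frac{q(p-2)}{p}\,\pi\equiv 0 \pmod{2\pi}.$$ Let $k$ be the degree of the unfolding covering $\pi_D:\tilde D\to D$. Then $k'\mid k$. If $p$ is even, then $k'\le k\le p$, and if $p$ is odd, then $k'\le k\le 2p$.
   Context: **Platonic surfaces.** Let $p\ge 3$. Take finitely many congruent regular Euclidean $p$-gons (the faces) and glue their sides isometrically in pairs so that the result $D$ is a connected closed oriented surface. A flag is a triple $(f,e,v)$ with $f$ a face, $e$ one of the $p$ boundary sides of the polygon $f$ (if one edge of the surface occurs twice on the boundary of $f$, these are two different sides of $f$), and $v$ an endpoint of that side. An automorphism of $D$ is a Euclidean isometry of $D$ carrying faces to faces; $\mathrm{Aut}(D)$ acts on flags. $D$ is a Platonic surface if $\mathrm{Aut}(D)$ is transitive on flags. It has Schläfli symbol $\{p,q\}$ if every face has $p$ sides and every vertex has degree $q$. **Unfolding.** $D$ minus its vertices is flat, and the holonomy of a closed curve in it is the change of angle when a tangent vector is parallel transported around the curve. The unfolding $\pi_D:\tilde D\to D$ is the smallest connected cover of $D$, branched only over vertices, such that every closed curve in $\tilde D$ avoiding the vertices has holonomy in $2\pi\mathbb{Z}$ (i.e. the completion of the covering of $D$ minus vertices corresponding to the kernel of the holonomy homomorphism to $\mathbb{R}/2\pi\mathbb{Z}$). *)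

theory Defs
  imports "HOL-Analysis.Analysis" "HOL-Library.Real_Mod"
begin

section \<open>Surfaces glued from congruent regular polygons\<close>

text \<open>
  Every face is a copy of one regular polygon in the complex plane, whose sides are numbered
  counterclockwise; \<open>(f, i)\<close> denotes the \<open>i\<close>-th side of the face \<open>f\<close>. The surface is oriented, so
  each face is identified with the model polygon by an orientation-preserving isometry, and
  paired sides are glued with their boundary orientations reversed.
\<close>

record 'f polygon_gluing =
  sides_per_face :: nat
  circumradius :: real
  faces :: "'f set"
  partner :: "'f \<times> nat \<Rightarrow> 'f \<times> nat"

definition face_sides :: "'f polygon_gluing \<Rightarrow> ('f \<times> nat) set" where
  "face_sides D = faces D \<times> {..<sides_per_face D}"

definition wf_gluing :: "'f polygon_gluing \<Rightarrow> bool" where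
  "wf_gluing D \<longleftrightarrow>
     sides_per_face D \<ge> 3 \<and> circumradius D > 0 \<and> finite (faces D) \<and> faces D \<noteq> {} \<and>
     (\<forall>s\<in>face_sides D. partner D s \<in> face_sides D \<and> partner D s \<noteq> s \<and>
        partner D (partner D s) = s)"

text \<open>The index is read modulo \<open>sides_per_face D\<close>, by periodicity of \<open>cis\<close>.\<close>
definition corner :: "'f polygon_gluing \<Rightarrow> nat \<Rightarrow> complex" where
  "corner D i = of_real (circumradius D) * cis (2 * pi * real i / real (sides_per_face D))"

definition polygon :: "'f polygon_gluing \<Rightarrow> complex set" where
  "polygon D = convex hull (corner D ` {..<sides_per_face D})"

definition side :: "'f polygon_gluing \<Rightarrow> nat \<Rightarrow> complex set" where
  "side D i = closed_segment (corner D i) (corner D (Suc i))"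

text \<open>
  \<open>gluing_map D (f, i)\<close> is the orientation-preserving isometry of the plane, with linear part
  \<open>gluing_rot D (f, i)\<close>, that sends \<open>corner i\<close> to \<open>corner (Suc j)\<close> and \<open>corner (Suc i)\<close> to
  \<open>corner j\<close>, where \<open>(g, j)\<close> is the partner of \<open>(f, i)\<close>. It is the change from the flat
  coordinates of \<open>f\<close> to those of \<open>g\<close> across the common edge.
\<close>
definition gluing_rot :: "'f polygon_gluing \<Rightarrow> 'f \<times> nat \<Rightarrow> complex" where
  "gluing_rot D s =
     (let i = snd s; j = snd (partner D s)
      in (corner D j - corner D (Suc j)) / (corner D (Suc i) - corner D i))"

definition gluing_map :: "'f polygon_gluing \<Rightarrow> 'f \<times> nat \<Rightarrow> complex \<Rightarrow> complex" where
  "gluing_map D s z =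
     corner D (Suc (snd (partner D s))) + gluing_rot D s * (z - corner D (snd s))"

definition glued :: "'f polygon_gluing \<Rightarrow> (('f \<times> complex) \<times> ('f \<times> complex)) set" where
  "glued D = {((f, z), (fst (partner D (f, i)), gluing_map D (f, i) z)) | f i z.
     (f, i) \<in> face_sides D \<and> z \<in> side D i}"

text \<open>A point of the surface is the set of all \<open>(f, z)\<close> representing it.\<close>
definition proj :: "'f polygon_gluing \<Rightarrow> 'f \<times> complex \<Rightarrow> ('f \<times> complex) set" where
  "proj D x = {y. (x, y) \<in> (glued D \<union> (glued D)\<inverse>)\<^sup>*}"

definition disjoint_polygons :: "'f polygon_gluing \<Rightarrow> ('f \<times> complex) topology" where
  "disjoint_polygons D =
     prod_topology (discrete_topology (faces D)) (top_of_set (polygon D))"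

definition quotient_topology :: "'a topology \<Rightarrow> ('a \<Rightarrow> 'b) \<Rightarrow> 'b topology" where
  "quotient_topology X f =
     topology (\<lambda>U. U \<subseteq> f ` topspace X \<and> openin X {x \<in> topspace X. f x \<in> U})"

lemma openin_quotient_topology:
  "openin (quotient_topology X f) U \<longleftrightarrow>
     U \<subseteq> f ` topspace X \<and> openin X {x \<in> topspace X. f x \<in> U}"
proof -
  let ?P = "\<lambda>U. U \<subseteq> f ` topspace X \<and> openin X {x \<in> topspace X. f x \<in> U}"
  have "istopology ?P"
    unfolding istopology_def
  proof (intro conjI allI impI)
    fix S T assume "?P S" "?P T"
    moreover have "{x \<in> topspace X. f x \<in> S \<inter> T} =
        {x \<in> topspace X. f x \<in> S} \<inter> {x \<in> topspace X. f x \<in> T}" by auto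
    ultimately show "S \<inter> T \<subseteq> f ` topspace X" "openin X {x \<in> topspace X. f x \<in> S \<inter> T}"
      by auto
  next
    fix \<K> assume K: "\<forall>K\<in>\<K>. ?P K"
    then show "\<Union>\<K> \<subseteq> f ` topspace X" by auto
    have "{x \<in> topspace X. f x \<in> \<Union>\<K>} = (\<Union>K\<in>\<K>. {x \<in> topspace X. f x \<in> K})" by auto
    then show "openin X {x \<in> topspace X. f x \<in> \<Union>\<K>}"
      using K by auto
  qed
  then show ?thesis
    by (simp add: quotient_topology_def topology_inverse')
qed

lemma topspace_quotient_topology [simp]: "topspace (quotient_topology X f) = f ` topspace X"
proof
  show "topspace (quotient_topology X f) \<subseteq> f ` topspace X"
    using openin_topspace[of "quotient_topology X f"] by (simp only: openin_quotient_topology)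
  have "{x \<in> topspace X. f x \<in> f ` topspace X} = topspace X" by auto
  then have "openin (quotient_topology X f) (f ` topspace X)"
    by (simp add: openin_quotient_topology)
  then show "f ` topspace X \<subseteq> topspace (quotient_topology X f)"
    by (rule openin_subset)
qed

lemma quotient_map_quotient_topology: "quotient_map X (quotient_topology X f) f"
  by (auto simp: quotient_map_def openin_quotient_topology)

definition surface :: "'f polygon_gluing \<Rightarrow> ('f \<times> complex) set topology" where
  "surface D = quotient_topology (disjoint_polygons D) (proj D)"

definition vertices :: "'f polygon_gluing \<Rightarrow> ('f \<times> complex) set set" where
  "vertices D = (\<lambda>(f, i). proj D (f, corner D i)) ` face_sides D"

text \<open>
  The degree of a vertex is its number of edge ends. An edge is a pair of glued sides with
  opposite orientations, so each edge end at \<open>v\<close> is the initial point of exactly one side.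
\<close>
definition vertex_degree :: "'f polygon_gluing \<Rightarrow> ('f \<times> complex) set \<Rightarrow> nat" where
  "vertex_degree D v = card {(f, i) \<in> face_sides D. proj D (f, corner D i) = v}"


section \<open>Platonic surfaces\<close>

text \<open>\<open>broken_path D x y l\<close>: some path of length \<open>l\<close> from \<open>x\<close> to \<open>y\<close> consists of finitely many
  straight segments, each inside one face.\<close>
inductive broken_path ::
    "'f polygon_gluing \<Rightarrow> ('f \<times> complex) set \<Rightarrow> ('f \<times> complex) set \<Rightarrow> real \<Rightarrow> bool"
  for D where
  refl: "x \<in> topspace (surface D) \<Longrightarrow> broken_path D x x 0"
| step: "broken_path D x (proj D (f, z)) l \<Longrightarrow> f \<in> faces D \<Longrightarrow> z \<in> polygon D \<Longrightarrow>
    w \<in> polygon D \<Longrightarrow> broken_path D x (proj D (f, w)) (l + dist z w)"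

definition surface_dist ::
    "'f polygon_gluing \<Rightarrow> ('f \<times> complex) set \<Rightarrow> ('f \<times> complex) set \<Rightarrow> real" where
  "surface_dist D x y = Inf {l. broken_path D x y l}"

definition face_set :: "'f polygon_gluing \<Rightarrow> 'f \<Rightarrow> ('f \<times> complex) set set" where
  "face_set D f = (\<lambda>z. proj D (f, z)) ` polygon D"

definition Aut ::
    "'f polygon_gluing \<Rightarrow> (('f \<times> complex) set \<Rightarrow> ('f \<times> complex) set) set" where
  "Aut D = {\<phi>. bij_betw \<phi> (topspace (surface D)) (topspace (surface D)) \<and>
     (\<forall>x\<in>topspace (surface D). \<forall>y\<in>topspace (surface D).
        surface_dist D (\<phi> x) (\<phi> y) = surface_dist D x y) \<and>
     (\<forall>f\<in>faces D. \<exists>g\<in>faces D. \<phi> ` face_set D f = face_set D g)}"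

text \<open>
  Sides and their endpoints are taken in the polygon, so that sides or corners of one face which
  coincide in the surface still give different flags.
\<close>
definition flags :: "'f polygon_gluing \<Rightarrow> ('f \<times> complex set \<times> complex) set" where
  "flags D = {(f, side D i, v) | f i v.
     (f, i) \<in> face_sides D \<and> v \<in> {corner D i, corner D (Suc i)}}"

text \<open>An automorphism acts on flags through the polygon isometry \<open>h\<close> that it induces on a face;
  \<open>h\<close> is determined by \<open>\<phi>\<close> because interior points of faces have a single representative.\<close>
definition maps_flag ::
    "'f polygon_gluing \<Rightarrow> (('f \<times> complex) set \<Rightarrow> ('f \<times> complex) set) \<Rightarrow>
     'f \<times> complex set \<times> complex \<Rightarrow> 'f \<times> complex set \<times> complex \<Rightarrow> bool" where
  "maps_flag D \<phi> = (\<lambda>(f, s, v) (f', s', v').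
     \<exists>h. (\<forall>z w. dist (h z) (h w) = dist z w) \<and> h ` polygon D = polygon D \<and>
       (\<forall>z\<in>polygon D. \<phi> (proj D (f, z)) = proj D (f', h z)) \<and>
       h ` s = s' \<and> h v = v')"

definition platonic_surface :: "'f polygon_gluing \<Rightarrow> bool" where
  "platonic_surface D \<longleftrightarrow> wf_gluing D \<and> connected_space (surface D) \<and>
     (\<forall>a\<in>flags D. \<forall>b\<in>flags D. \<exists>\<phi>\<in>Aut D. maps_flag D \<phi> a b)"

definition has_schlafli_symbol :: "'f polygon_gluing \<Rightarrow> nat \<Rightarrow> nat \<Rightarrow> bool" where
  "has_schlafli_symbol D p q \<longleftrightarrow>
     sides_per_face D = p \<and> (\<forall>v\<in>vertices D. vertex_degree D v = q)"


section \<open>Holonomy\<close>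

definition punctured_surface :: "'f polygon_gluing \<Rightarrow> ('f \<times> complex) set topology" where
  "punctured_surface D = subtopology (surface D) (topspace (surface D) - vertices D)"

definition closed_curve :: "'a topology \<Rightarrow> (real \<Rightarrow> 'a) \<Rightarrow> bool" where
  "closed_curve X \<gamma> \<longleftrightarrow> pathin X \<gamma> \<and> \<gamma> 0 = \<gamma> 1"

text \<open>
  A parallel field of unit tangent vectors along a curve \<open>\<gamma>\<close> avoiding the vertices:
  \<open>U t (f, z)\<close> is the vector at \<open>\<gamma> t\<close> in the flat coordinates of the face \<open>f\<close>, for each
  representative \<open>(f, z)\<close> of \<open>\<gamma> t\<close>. The second condition says that the coordinates in the two
  faces at an edge belong to the same tangent vector, the third that in flat coordinates the
  field is locally constant.
\<close>
definition parallel_along ::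
    "'f polygon_gluing \<Rightarrow> (real \<Rightarrow> ('f \<times> complex) set) \<Rightarrow> (real \<Rightarrow> 'f \<times> complex \<Rightarrow> complex) \<Rightarrow> bool"
  where
  "parallel_along D \<gamma> U \<longleftrightarrow>
     (\<forall>t\<in>{0..1}. \<forall>r\<in>\<gamma> t. norm (U t r) = 1) \<and>
     (\<forall>t\<in>{0..1}. \<forall>f i z. (f, i) \<in> face_sides D \<and> (f, z) \<in> \<gamma> t \<and> z \<in> side D i \<longrightarrow>
        U t (fst (partner D (f, i)), gluing_map D (f, i) z) = gluing_rot D (f, i) * U t (f, z)) \<and>
     (\<forall>t\<in>{0..1}. \<forall>(f, z)\<in>\<gamma> t. \<exists>\<epsilon>>0. \<forall>t'\<in>{0..1}. \<forall>z'.
        \<bar>t' - t\<bar> < \<epsilon> \<and> dist z' z < \<epsilon> \<and> (f, z') \<in> \<gamma> t' \<longrightarrow> U t' (f, z') = U t (f, z))"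

text \<open>The angle \<open>\<theta>\<close> is determined by the closed curve only modulo \<open>2 * pi\<close>.\<close>
definition has_holonomy ::
    "'f polygon_gluing \<Rightarrow> (real \<Rightarrow> ('f \<times> complex) set) \<Rightarrow> real \<Rightarrow> bool" where
  "has_holonomy D \<gamma> \<theta> \<longleftrightarrow>
     (\<exists>U. parallel_along D \<gamma> U \<and> (\<forall>r\<in>\<gamma> 0. U 1 r = cis \<theta> * U 0 r))"

definition trivial_holonomy ::
    "'f polygon_gluing \<Rightarrow> (real \<Rightarrow> ('f \<times> complex) set) \<Rightarrow> bool" where
  "trivial_holonomy D \<gamma> \<longleftrightarrow> (\<exists>n::int. has_holonomy D \<gamma> (2 * pi * of_int n))"


section \<open>The unfolding\<close>

definition covering_map :: "'a topology \<Rightarrow> 'b topology \<Rightarrow> ('a \<Rightarrow> 'b) \<Rightarrow> bool" where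
  "covering_map X Y p \<longleftrightarrow>
     continuous_map X Y p \<and> p ` topspace X = topspace Y \<and>
     (\<forall>y\<in>topspace Y. \<exists>W. openin Y W \<and> y \<in> W \<and>
        (\<exists>\<V>. \<Union>\<V> = {x \<in> topspace X. p x \<in> W} \<and> disjoint \<V> \<and>
          (\<forall>V\<in>\<V>. openin X V \<and> homeomorphic_map (subtopology X V) (subtopology Y W) p)))"

definition punctured_cover ::
    "'f polygon_gluing \<Rightarrow> 'e topology \<Rightarrow> ('e \<Rightarrow> ('f \<times> complex) set) \<Rightarrow> 'e topology" where
  "punctured_cover D E \<pi> = subtopology E {e \<in> topspace E. \<pi> e \<notin> vertices D}"

text \<open>
  The local condition at the vertices says that, over a small disc around a vertex, \<open>\<pi>\<close> is a
  disjoint union of maps \<open>z \<mapsto> z ^ m\<close>. In particular every puncture of the cover is filled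
  in, that is, \<open>E\<close> is the completion of the punctured cover.
\<close>
definition branched_cover ::
    "'f polygon_gluing \<Rightarrow> 'e topology \<Rightarrow> ('e \<Rightarrow> ('f \<times> complex) set) \<Rightarrow> bool" where
  "branched_cover D E \<pi> \<longleftrightarrow>
     continuous_map E (surface D) \<pi> \<and>
     covering_map (punctured_cover D E \<pi>) (punctured_surface D) \<pi> \<and>
     (\<forall>v\<in>vertices D. \<exists>W \<phi>.
        openin (surface D) W \<and> W \<inter> vertices D = {v} \<and>
        homeomorphic_map (subtopology (surface D) W) (top_of_set (ball (0::complex) 1)) \<phi> \<and>
        \<phi> v = 0 \<and>
        (\<forall>C\<in>connected_components_of (subtopology E {e \<in> topspace E. \<pi> e \<in> W}).
           openin E C \<and>
           (\<exists>m \<psi>. m \<ge> (1::nat) \<and>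
              homeomorphic_map (subtopology E C) (top_of_set (ball (0::complex) 1)) \<psi> \<and>
              (\<forall>e\<in>C. \<phi> (\<pi> e) = \<psi> e ^ m))))"

text \<open>
  The last condition says that the punctured cover corresponds to the kernel of the holonomy
  homomorphism: the closed curves at \<open>\<pi> e\<close> that lift to closed curves at \<open>e\<close> are exactly those
  whose holonomy is a multiple of \<open>2 * pi\<close>. By homotopy lifting this is the equality between the
  image of the fundamental group at \<open>e\<close> and that kernel.
\<close>
definition is_unfolding ::
    "'f polygon_gluing \<Rightarrow> 'e topology \<Rightarrow> ('e \<Rightarrow> ('f \<times> complex) set) \<Rightarrow> bool" where
  "is_unfolding D E \<pi> \<longleftrightarrow>
     branched_cover D E \<pi> \<and> connected_space (punctured_cover D E \<pi>) \<and>
     (\<forall>e\<in>topspace (punctured_cover D E \<pi>). \<forall>\<gamma>.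
        closed_curve (punctured_surface D) \<gamma> \<and> \<gamma> 0 = \<pi> e \<longrightarrow>
        (trivial_holonomy D \<gamma> \<longleftrightarrow>
          (\<exists>\<delta>. closed_curve (punctured_cover D E \<pi>) \<delta> \<and> \<delta> 0 = e \<and>
             (\<forall>t\<in>{0..1}. \<pi> (\<delta> t) = \<gamma> t))))"

end

theory Submission
  imports Defs "HOL-Combinatorics.Orbits"
begin

text \<open>
  Parallel transport of unit tangent vectors along paths avoiding the vertices assigns to every closed
  path at \<open>x\<close> a unit complex number, and the values form a group \<open>H\<close>. Transporting along the
  projections of paths upstairs, and using that a closed path lifts to a closed path exactly if its
  holonomy is trivial, one gets a bijection between the fibre over \<open>x\<close> and \<open>H\<close>; hence \<open>k = |H|\<close>.
  In the coordinates of the polygons a transition between faces is \<open>- \<zeta>\<^sup>m\<close> with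
  \<open>\<zeta> = cis (2 * pi / p)\<close>, so \<open>H\<close> consists of roots of unity of order \<open>p\<close> (\<open>p\<close> even) or \<open>2 * p\<close>
  (\<open>p\<close> odd), which bounds \<open>k\<close>. A path running once around a vertex crosses \<open>q\<close> edges and has holonomy
  \<open>(- 1 / \<zeta>) ^ q = cis (q * (p - 2) / p * pi)\<close>, an element of \<open>H\<close> of order \<open>k'\<close>; so \<open>k'\<close> divides \<open>|H|\<close>.
\<close>

section \<open>Paths and covering maps\<close>

text \<open>The unfolding is characterised by lifts of closed curves, so the argument works with
  single paths throughout and no homotopy enters. The price is that transport has to be built by
  hand on a quotient space: a point is a finite set of coordinate representatives, a tangent vector
  there is a compatible family of unit numbers (\<open>frame\<close>), and a transport coefficient
  (\<open>hol\<close>) belongs to a path together with a representative at each end. The geometric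
  obstacle is to control the identifications near a point. Two facts do this: distinct sides meet
  only in corners, and gluing preserves the distance to the centre of the face. Two quantities are
  unchanged by gluing and hence constant along a path: the quotient of two parallel fields, which
  makes \<open>hol\<close> well defined, and a suitable power of one field, which makes holonomies
  roots of unity. The sign in the transitions comes from gluing sides with opposite directions; -1
  is a \<open>p\<close>-th root of unity only for even \<open>p\<close>, whence the exponent
  \<open>2 * p\<close> for odd \<open>p\<close>. Divisibility by \<open>k'\<close> comes from
  multiplying all elements of the finite set \<open>H\<close>.\<close>

definition join_path :: "(real \<Rightarrow> 'a) \<Rightarrow> (real \<Rightarrow> 'a) \<Rightarrow> real \<Rightarrow> 'a" where
  "join_path g h t = (if t \<le> 1/2 then g (2 * t) else h (2 * t - 1))"

definition rev_path :: "(real \<Rightarrow> 'a) \<Rightarrow> real \<Rightarrow> 'a" where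
  "rev_path g t = g (1 - t)"

lemma join_path_0 [simp]: "join_path g h 0 = g 0"
  and join_path_1 [simp]: "join_path g h 1 = h 1"
  and rev_path_0 [simp]: "rev_path g 0 = g 1"
  and rev_path_1 [simp]: "rev_path g 1 = g 0"
  by (simp_all add: join_path_def rev_path_def)

lemma join_path_first_half: "s \<in> {0..1} \<Longrightarrow> join_path g h (s / 2) = g s"
  by (simp add: join_path_def)

lemma join_path_second_half:
  "g 1 = h 0 \<Longrightarrow> s \<in> {0..1} \<Longrightarrow> join_path g h ((s + 1) / 2) = h s"
  by (auto simp: join_path_def add_divide_distrib)

lemma continuous_map_paste_intervals:
  fixes a b c :: real
  assumes "a \<le> b" "b \<le> c"
    and g: "continuous_map (top_of_set {a..b}) X g"
    and h: "continuous_map (top_of_set {b..c}) X h"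
    and "g b = h b"
  shows "continuous_map (top_of_set {a..c}) X (\<lambda>t. if t \<le> b then g t else h t)"
proof (rule continuous_map_cases_le)
  have eq: "{a..c} \<inter> {x. x \<in> topspace (top_of_set {a..c}) \<and> x \<le> b} = {a..b}"
    "{a..c} \<inter> {x. x \<in> topspace (top_of_set {a..c}) \<and> b \<le> x} = {b..c}"
    using assms by auto
  show "continuous_map (subtopology (top_of_set {a..c}) {x \<in> topspace (top_of_set {a..c}). x \<le> b}) X g"
    using g by (simp only: subtopology_subtopology eq)
  show "continuous_map (subtopology (top_of_set {a..c}) {x \<in> topspace (top_of_set {a..c}). b \<le> x}) X h"
    using h by (simp only: subtopology_subtopology eq)
qed (use assms in auto)

lemma pathin_join_path:
  assumes g: "pathin X g" and h: "pathin X h" and "g 1 = h 0"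
  shows "pathin X (join_path g h)"
proof -
  have "continuous_map (top_of_set {0..1/2}) (top_of_set {0..1}) (\<lambda>t::real. 2 * t)"
    by (auto intro: continuous_on_mult continuous_on_const continuous_on_id)
  then have 1: "continuous_map (top_of_set {0..1/2}) X (\<lambda>t. g (2 * t))"
    using continuous_map_compose g unfolding pathin_def o_def by metis
  have "continuous_map (top_of_set {1/2..1}) (top_of_set {0..1}) (\<lambda>t::real. 2 * t - 1)"
    by (auto intro: continuous_on_diff continuous_on_mult continuous_on_const continuous_on_id)
  then have 2: "continuous_map (top_of_set {1/2..1}) X (\<lambda>t. h (2 * t - 1))"
    using continuous_map_compose h unfolding pathin_def o_def by metis
  show ?thesis
    using continuous_map_paste_intervals [OF _ _ 1 2] assms(3)
    by (simp add: pathin_def join_path_def [abs_def])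
qed

lemma pathin_rev_path:
  assumes g: "pathin X g" shows "pathin X (rev_path g)"
proof -
  have "continuous_map (top_of_set {0..1}) (top_of_set {0..1}) (\<lambda>t::real. 1 - t)"
    by (auto intro: continuous_on_diff continuous_on_const continuous_on_id)
  then show ?thesis
    using continuous_map_compose g unfolding pathin_def o_def rev_path_def [abs_def] by metis
qed

lemma pathin_into_topspace: "pathin X g \<Longrightarrow> t \<in> {0..1} \<Longrightarrow> g t \<in> topspace X"
  using path_image_subset_topspace by blast

lemma pathin_openin_preimage:
  assumes "pathin X g" "openin X W" "t \<in> {0..1}" "g t \<in> W"
  obtains d where "d > 0" "\<And>s. s \<in> {0..1} \<Longrightarrow> \<bar>s - t\<bar> < d \<Longrightarrow> g s \<in> W"
proof -
  have "openin (top_of_set {0..1}) {s \<in> {0..1}. g s \<in> W}"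
    using assms(1,2) by (auto simp: pathin_def continuous_map)
  then obtain d where "d > 0"
    and "\<And>s. s \<in> {0..1} \<Longrightarrow> dist s t < d \<Longrightarrow> s \<in> {s \<in> {0..1}. g s \<in> W}"
    using assms(3,4) unfolding openin_euclidean_subtopology_iff
    by (metis (mono_tags, lifting) mem_Collect_eq)
  then show thesis
    by (intro that) (auto simp: dist_real_def)
qed

section \<open>Local path connectedness\<close>

lemma locally_path_connected_space_convex:
  fixes S :: "'a::real_normed_vector set"
  assumes "convex S"
  shows "locally_path_connected_space (top_of_set S)"
  unfolding locally_path_connected_space_im_kleinen
proof (intro allI impI, elim conjE)
  fix V x assume V: "openin (top_of_set S) V" and x: "x \<in> V"
  then have VS: "V \<subseteq> S" and "\<exists>e>0. ball x e \<inter> S \<subseteq> V"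
    by (simp_all add: openin_contains_ball)
  then obtain e where e: "e > 0" "ball x e \<inter> S \<subseteq> V"
    by blast
  \<comment> \<open>The intersection with a ball is again convex, so segments from \<open>x\<close>
    stay inside it.\<close>
  let ?U = "S \<inter> ball x e"
  have U: "?U \<subseteq> V" using e(2) by blast
  have "\<exists>C. path_connectedin (top_of_set S) C \<and> C \<subseteq> V \<and> x \<in> C \<and> y \<in> C" if y: "y \<in> ?U" for y
  proof (intro exI conjI)
    have "convex ?U" using assms by (simp add: convex_Int)
    moreover have "x \<in> ?U" using x VS e(1) by auto
    ultimately have *: "closed_segment x y \<subseteq> ?U"
      using y by (intro closed_segment_subset)
    then show "closed_segment x y \<subseteq> V" using U by (rule subset_trans)
    show "path_connectedin (top_of_set S) (closed_segment x y)"
      unfolding path_connectedin_subtopology path_connectedin_euclidean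
      using * by (intro conjI convex_imp_path_connected convex_closed_segment) blast
    show "x \<in> closed_segment x y" "y \<in> closed_segment x y"
      by simp_all
  qed
  then have "\<forall>y\<in>?U. \<exists>C. path_connectedin (top_of_set S) C \<and> C \<subseteq> V \<and> x \<in> C \<and> y \<in> C"
    by (rule ballI)
  moreover have "openin (top_of_set S) ?U"
    by (rule openin_open_Int) (rule open_ball)
  moreover have "x \<in> ?U"
    using x VS e(1) by auto
  ultimately show "\<exists>U. openin (top_of_set S) U \<and> x \<in> U \<and> U \<subseteq> V \<and>
      (\<forall>y\<in>U. \<exists>C. path_connectedin (top_of_set S) C \<and> C \<subseteq> V \<and> x \<in> C \<and> y \<in> C)"
    using U by (intro exI [of _ ?U] conjI)
qed

lemma locally_path_connected_space_openin_cover: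
  assumes "\<And>x. x \<in> topspace X \<Longrightarrow>
    \<exists>V. openin X V \<and> x \<in> V \<and> locally_path_connected_space (subtopology X V)"
  shows "locally_path_connected_space X"
  unfolding locally_path_connected_space
proof (intro allI impI, elim conjE)
  fix W x assume W: "openin X W" "x \<in> W"
  then have "x \<in> topspace X" using openin_subset by blast
  then obtain V where V: "openin X V" "x \<in> V" "locally_path_connected_space (subtopology X V)"
    using assms by blast
  have "openin (subtopology X V) (V \<inter> W)" "x \<in> V \<inter> W"
    using W V by (simp_all add: openin_subtopology_Int2)
  then obtain U where U: "openin (subtopology X V) U" "path_connectedin (subtopology X V) U"
      "x \<in> U" "U \<subseteq> V \<inter> W"
    using V(3) unfolding locally_path_connected_space by blast
  then have "openin X U" "path_connectedin X U"
    using V(1) by (simp_all add: path_connectedin_subtopology openin_open_subtopology)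
  then show "\<exists>U. openin X U \<and> path_connectedin X U \<and> x \<in> U \<and> U \<subseteq> W"
    using U by blast
qed

section \<open>Lifting paths through covering maps\<close>

lemma covering_map_sheet:
  assumes "covering_map X Y p" "y \<in> topspace Y"
  obtains W \<V> where "openin Y W" "y \<in> W" "\<Union>\<V> = {x \<in> topspace X. p x \<in> W}" "disjoint \<V>"
    "\<And>V. V \<in> \<V> \<Longrightarrow> openin X V \<and> homeomorphic_map (subtopology X V) (subtopology Y W) p"
  using assms unfolding covering_map_def by metis

text \<open>Each sheet is open and homeomorphic to an open subset of \<open>Y\<close>, and the
  property is local.\<close>

lemma covering_map_locally_path_connected_space:
  assumes cov: "covering_map X Y p" and Y: "locally_path_connected_space Y"
  shows "locally_path_connected_space X"
proof (rule locally_path_connected_space_openin_cover)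
  fix x assume x: "x \<in> topspace X"
  then have "p x \<in> topspace Y"
    using cov by (auto simp: covering_map_def)
  with cov obtain W \<V> where W: "openin Y W" "p x \<in> W" "\<Union>\<V> = {x \<in> topspace X. p x \<in> W}" "disjoint \<V>"
    and V: "\<And>V. V \<in> \<V> \<Longrightarrow> openin X V \<and> homeomorphic_map (subtopology X V) (subtopology Y W) p"
    by (rule covering_map_sheet) blast
  then obtain V where "V \<in> \<V>" "x \<in> V" using x by blast
  then show "\<exists>V. openin X V \<and> x \<in> V \<and> locally_path_connected_space (subtopology X V)"
    using V W(1) Y homeomorphic_locally_path_connected_space
      homeomorphic_map_imp_homeomorphic_space locally_path_connected_space_open_subset
    by metis
qed

lemma covering_map_lift_unique:
  assumes cov: "covering_map X Y p" and d1: "pathin X d1" and d2: "pathin X d2"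
    and eq: "\<And>t. t \<in> {0..1} \<Longrightarrow> p (d1 t) = p (d2 t)" and "d1 0 = d2 0"
  shows "d1 1 = d2 1"
proof -
  have "0 \<le> (0::real) \<and> (1::real) \<le> 1 \<longrightarrow> d1 0 = d2 0 \<longrightarrow> d1 1 = d2 1"
  \<comment> \<open>The predicate is an implication between the two ends of a subinterval. Such
    implications compose, so bisection reduces the claim to short intervals around each
    \<open>t\<close>.\<close>
  proof (rule Bolzano [where P = "\<lambda>a b. 0 \<le> a \<and> b \<le> 1 \<longrightarrow> d1 a = d2 a \<longrightarrow> d1 b = d2 b"])
    fix t :: real assume t: "0 \<le> t" "t \<le> 1"
    have "p (d1 t) \<in> topspace Y"
      using cov pathin_into_topspace [OF d1] t by (auto simp: covering_map_def)
    with cov obtain W \<V> where W: "openin Y W" "p (d1 t) \<in> W"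
        "\<Union>\<V> = {x \<in> topspace X. p x \<in> W}" "disjoint \<V>"
      and V: "\<And>V. V \<in> \<V> \<Longrightarrow> openin X V \<and> homeomorphic_map (subtopology X V) (subtopology Y W) p"
      by (rule covering_map_sheet) blast
    have "d1 t \<in> \<Union>\<V>" "d2 t \<in> \<Union>\<V>"
      using W(2,3) pathin_into_topspace [OF d1] pathin_into_topspace [OF d2] eq t by auto
    then obtain V1 V2 where V12: "V1 \<in> \<V>" "V2 \<in> \<V>" "d1 t \<in> V1" "d2 t \<in> V2" by blast
    obtain r1 where r1: "r1 > 0" "\<And>s. s \<in> {0..1} \<Longrightarrow> \<bar>s - t\<bar> < r1 \<Longrightarrow> d1 s \<in> V1"
      using pathin_openin_preimage [OF d1, of V1 t] V V12 t by (metis atLeastAtMost_iff)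
    obtain r2 where r2: "r2 > 0" "\<And>s. s \<in> {0..1} \<Longrightarrow> \<bar>s - t\<bar> < r2 \<Longrightarrow> d2 s \<in> V2"
      using pathin_openin_preimage [OF d2, of V2 t] V V12 t by (metis atLeastAtMost_iff)
    show "\<exists>d>0. \<forall>a b. a \<le> t \<and> t \<le> b \<and> b - a < d \<longrightarrow>
        0 \<le> a \<and> b \<le> 1 \<longrightarrow> d1 a = d2 a \<longrightarrow> d1 b = d2 b"
    proof (intro exI[of _ "min r1 r2"] conjI allI impI)
      fix a b assume ab: "a \<le> t \<and> t \<le> b \<and> b - a < min r1 r2" "0 \<le> a \<and> b \<le> 1" "d1 a = d2 a"
      \<comment> \<open>On a short interval each lift stays in its own sheet. Agreement at
        \<open>a\<close> makes the two sheets meet, so by disjointness they are equal, and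
        \<open>p\<close> is injective there.\<close>
      have "d1 a \<in> V1" "d2 a \<in> V2" and b: "d1 b \<in> V1" "d2 b \<in> V2"
        using ab(1,2) by (auto intro!: r1(2) r2(2))
      then have "V1 = V2"
        using W(4) V12 ab(3) unfolding pairwise_def disjnt_def by fastforce
      moreover have "inj_on p V1"
        using homeomorphic_imp_injective_map V V12(1) openin_subset
        by (metis topspace_subtopology_subset)
      ultimately show "d1 b = d2 b"
        using inj_onD [of p V1 "d1 b" "d2 b"] b eq [of b] ab(1,2) by auto
    qed (use r1 r2 in auto)
  qed auto
  then show ?thesis using assms by simp
qed

lemma covering_map_lift:
  assumes cov: "covering_map X Y p" and g: "pathin Y g" and e: "e \<in> topspace X" "p e = g 0"
  obtains d where "pathin X d" "d 0 = e" "\<And>t. t \<in> {0..1} \<Longrightarrow> p (d t) = g t"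
proof -
  \<comment> \<open>All start points over \<open>g a\<close> are quantified inside the predicate, so
    that the lift over the second interval can begin where the first one ended.\<close>
  let ?P = "\<lambda>a b. 0 \<le> a \<and> a \<le> b \<and> b \<le> 1 \<longrightarrow> (\<forall>e\<in>topspace X. p e = g a \<longrightarrow>
      (\<exists>d. continuous_map (top_of_set {a..b}) X d \<and> d a = e \<and> (\<forall>t\<in>{a..b}. p (d t) = g t)))"
  have "?P 0 1"
  proof (rule Bolzano [where P = ?P])
    fix a b c :: real
    assume ab: "?P a b" and bc: "?P b c" and le: "a \<le> b" "b \<le> c"
    show "?P a c"
    proof (intro impI ballI)
      fix e assume ac: "0 \<le> a \<and> a \<le> c \<and> c \<le> 1" and e: "e \<in> topspace X" "p e = g a"
      obtain d1 where d1: "continuous_map (top_of_set {a..b}) X d1" "d1 a = e"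
          "\<And>t. t \<in> {a..b} \<Longrightarrow> p (d1 t) = g t"
        using ab ac le e by (meson order_trans)
      have "d1 b \<in> topspace X"
        using d1(1) le by (force simp: continuous_map_def)
      then obtain d2 where d2: "continuous_map (top_of_set {b..c}) X d2" "d2 b = d1 b"
          "\<And>t. t \<in> {b..c} \<Longrightarrow> p (d2 t) = g t"
        using bc ac le d1(3)[of b] by (metis atLeastAtMost_iff order_refl order_trans)
      show "\<exists>d. continuous_map (top_of_set {a..c}) X d \<and> d a = e \<and> (\<forall>t\<in>{a..c}. p (d t) = g t)"
        using continuous_map_paste_intervals [OF le d1(1) d2(1)] d1 d2 le
        by (intro exI[of _ "\<lambda>t. if t \<le> b then d1 t else d2 t"]) auto
    qed
  next
    fix t :: real assume t: "0 \<le> t" "t \<le> 1"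
    have "g t \<in> topspace Y" using pathin_into_topspace [OF g] t by auto
    with cov obtain W \<V> where W: "openin Y W" "g t \<in> W"
        "\<Union>\<V> = {x \<in> topspace X. p x \<in> W}" "disjoint \<V>"
      and V: "\<And>V. V \<in> \<V> \<Longrightarrow> openin X V \<and> homeomorphic_map (subtopology X V) (subtopology Y W) p"
      by (rule covering_map_sheet) blast
    obtain r where r: "r > 0" "\<And>s. s \<in> {0..1} \<Longrightarrow> \<bar>s - t\<bar> < r \<Longrightarrow> g s \<in> W"
      using pathin_openin_preimage [OF g, of W t] W t by auto
    show "\<exists>r>0. \<forall>a b. a \<le> t \<and> t \<le> b \<and> b - a < r \<longrightarrow> ?P a b"
    proof (intro exI[of _ r] conjI allI impI ballI)
      fix a b e assume ab: "a \<le> t \<and> t \<le> b \<and> b - a < r" "0 \<le> a \<and> a \<le> b \<and> b \<le> 1"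
        and e: "e \<in> topspace X" "p e = g a"
      have gW: "g s \<in> W" if "s \<in> {a..b}" for s
        using that ab by (intro r(2)) auto
      then have "e \<in> \<Union>\<V>" using W(3) e ab by auto
      then obtain S where S: "S \<in> \<V>" "e \<in> S" by blast
      obtain q where q: "homeomorphic_maps (subtopology X S) (subtopology Y W) p q"
        using V [OF S(1)] homeomorphic_map_maps by metis
      have "continuous_map (top_of_set {a..b}) (subtopology Y W) g"
        using g ab gW continuous_map_from_subtopology_mono [of euclideanreal "{0..1}" Y g "{a..b}"]
        by (auto simp: pathin_def intro!: continuous_map_into_subtopology)
      then have "continuous_map (top_of_set {a..b}) (subtopology X S) (q \<circ> g)"
        using q by (auto simp: homeomorphic_maps_def intro: continuous_map_compose)
      then have "continuous_map (top_of_set {a..b}) X (q \<circ> g)"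
        by (rule continuous_map_into_fulltopology)
      moreover have "(q \<circ> g) a = e"
        using q e S(2) by (simp add: homeomorphic_maps_def flip: e(2))
      moreover have "p ((q \<circ> g) s) = g s" if "s \<in> {a..b}" for s
        using q gW [OF that] openin_subset [OF W(1)] by (auto simp: homeomorphic_maps_def)
      ultimately show "\<exists>d. continuous_map (top_of_set {a..b}) X d \<and> d a = e \<and> (\<forall>t\<in>{a..b}. p (d t) = g t)"
        by blast
    qed (use r in auto)
  qed auto
  then show thesis
    using that e by (auto simp: pathin_def)
qed

section \<open>Polygon geometry and the topology of the surface\<close>

locale polygon_surface =
  fixes D :: "'f polygon_gluing"
  assumes wf: "wf_gluing D"
begin

abbreviation p :: nat where "p \<equiv> sides_per_face D"
abbreviation R :: real where "R \<equiv> circumradius D"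

definition zeta :: complex where "zeta = cis (2 * pi / real p)"

text \<open>An affine parameter on side \<open>i\<close>. The factor \<open>zeta ^ i\<close>
  isolates the rotation from side 0, so norms do not depend on \<open>i\<close>; gluing will
  exchange \<open>s\<close> and \<open>1 - s\<close>.\<close>

definition edge_point :: "nat \<Rightarrow> real \<Rightarrow> complex" where
  "edge_point i s = zeta ^ i * (of_real R * (of_real (1 - s) + of_real s * zeta))"

lemma p_ge_3: "p \<ge> 3" and R_pos: "R > 0" and finite_faces: "finite (faces D)"
  and faces_nonempty: "faces D \<noteq> {}"
  using wf by (auto simp: wf_gluing_def)

lemma partner_closed: "s \<in> face_sides D \<Longrightarrow> partner D s \<in> face_sides D"
  and partner_neq: "s \<in> face_sides D \<Longrightarrow> partner D s \<noteq> s"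
  and partner_partner: "s \<in> face_sides D \<Longrightarrow> partner D (partner D s) = s"
  using wf by (auto simp: wf_gluing_def)

lemma mem_face_sides: "(f, i) \<in> face_sides D \<longleftrightarrow> f \<in> faces D \<and> i < p"
  by (auto simp: face_sides_def)

lemma finite_face_sides: "finite (face_sides D)"
  by (simp add: face_sides_def finite_faces)

lemma norm_zeta [simp]: "norm zeta = 1" and zeta_nonzero [simp]: "zeta \<noteq> 0"
  by (simp_all add: zeta_def)

lemma zeta_cnj: "zeta * cnj zeta = 1"
  by (simp add: complex_norm_square [symmetric])

lemma zeta_power: "zeta ^ i = cis (2 * pi * real i / real p)"
  unfolding zeta_def Complex.DeMoivre by (simp add: mult_ac)

lemma zeta_power_p [simp]: "zeta ^ p = 1"
  using p_ge_3 by (simp add: zeta_power)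

lemma zeta_power_mod: "zeta ^ (i mod p) = zeta ^ i"
proof -
  have "zeta ^ i = zeta ^ (p * (i div p) + i mod p)" by simp
  also have "\<dots> = zeta ^ (i mod p)" by (simp only: power_add power_mult zeta_power_p) simp
  finally show ?thesis ..
qed

lemma zeta_power_inj:
  assumes "zeta ^ i = zeta ^ j" "i < p" "j < p" shows "i = j"
proof -
  have "inj_on (\<lambda>k. cis (2 * pi * real k / real p)) {..<p}"
    using Complex.bij_betw_roots_unity [of p] p_ge_3 by (auto simp: bij_betw_def)
  then show ?thesis using assms by (auto simp: zeta_power dest: inj_onD)
qed

lemma Re_zeta_less: "Re zeta < 1" and Re_zeta_greater: "Re zeta > -1"
proof -
  have p: "0 < 2 * pi / real p" "2 * pi / real p < pi"
    using p_ge_3 by (simp_all add: divide_less_eq)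
  show "Re zeta < 1"
    using cos_monotone_0_pi [of 0 "2 * pi / real p"] p by (simp add: zeta_def)
  show "Re zeta > -1"
    using cos_monotone_0_pi [of "2 * pi / real p" pi] p by (simp add: zeta_def)
qed

lemma zeta_neq_1 [simp]: "zeta \<noteq> 1"
  using Re_zeta_less by auto

text \<open>Cosine decreases on the interval from 0 to \<open>pi\<close>, so the smallest positive
  multiple wins there; angles beyond \<open>pi\<close> are reflected to the multiple
  \<open>p - m\<close>.\<close>

lemma cos_multiple_le:
  assumes "0 < m" "m < p" shows "cos (2 * pi * real m / real p) \<le> Re zeta"
proof (cases "2 * m \<le> p")
  case True
  then have "real m * 2 \<le> real p" by linarith
  then have "2 * pi * real m / real p \<le> pi"
    using assms by (simp add: divide_le_eq field_simps)
  moreover have "2 * pi / real p \<le> 2 * pi * real m / real p"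
    using assms by (intro divide_right_mono) auto
  ultimately show ?thesis
    using cos_monotone_0_pi_le [of "2 * pi / real p" "2 * pi * real m / real p"] by (simp add: zeta_def)
next
  case False
  define k where "k = p - m"
  have k: "0 < k" "real k = real p - real m" "2 * k \<le> p" using False assms by (auto simp: k_def)
  have "2 * pi * real m / real p = 2 * pi - 2 * pi * real k / real p"
    unfolding k(2) using assms by (simp add: divide_simps) (simp add: algebra_simps)
  then have "cos (2 * pi * real m / real p) = cos (2 * pi - 2 * pi * real k / real p)"
    by (rule arg_cong)
  also have "\<dots> = cos (2 * pi * real k / real p)" by simp
  finally have eq: "cos (2 * pi * real m / real p) = cos (2 * pi * real k / real p)" .
  have "real k * 2 \<le> real p" using k by linarith
  then have "2 * pi * real k / real p \<le> pi"
    using assms by (simp add: divide_le_eq field_simps)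
  moreover have "2 * pi / real p \<le> 2 * pi * real k / real p"
    using k assms by (intro divide_right_mono) auto
  ultimately show ?thesis
    using cos_monotone_0_pi_le [of "2 * pi / real p" "2 * pi * real k / real p"] eq by (simp add: zeta_def)
qed

lemma Re_zeta_power_quotient_le:
  assumes "i < p" "j < p" "i \<noteq> j" shows "Re (zeta ^ j * cnj (zeta ^ i)) \<le> Re zeta"
proof -
  have "zeta ^ j * cnj (zeta ^ i) = cis (2 * pi * real j / real p - 2 * pi * real i / real p)"
    by (simp add: zeta_power cis_cnj cis_mult)
  then have Re: "Re (zeta ^ j * cnj (zeta ^ i)) = cos (2 * pi * real j / real p - 2 * pi * real i / real p)"
    by simp
  consider "i < j" | "j < i" using assms by linarith
  then show ?thesis
  proof cases
    case 1
    then show ?thesis using cos_multiple_le [of "j - i"] assms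
      unfolding Re by (simp add: of_nat_diff right_diff_distrib diff_divide_distrib)
  next
    case 2
    have "cos (2 * pi * real j / real p - 2 * pi * real i / real p) =
        cos (2 * pi * real i / real p - 2 * pi * real j / real p)"
      by (metis cos_minus minus_diff_eq)
    then show ?thesis using cos_multiple_le [of "i - j"] assms 2
      unfolding Re by (simp add: of_nat_diff right_diff_distrib diff_divide_distrib)
  qed
qed

section \<open>Corners and sides of the model polygon\<close>

lemma corner_eq: "corner D i = of_real R * zeta ^ i"
  by (simp add: corner_def zeta_power)

lemma corner_mod: "corner D (i mod p) = corner D i"
  by (simp add: corner_eq zeta_power_mod)

lemma corner_inj: "corner D i = corner D j \<Longrightarrow> i < p \<Longrightarrow> j < p \<Longrightarrow> i = j"
  using R_pos by (auto simp: corner_eq intro: zeta_power_inj)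

lemma norm_corner: "norm (corner D i) = R"
  using R_pos by (simp add: corner_eq norm_mult norm_power)

lemma corner_in_corners: "corner D i \<in> corner D ` {..<p}"
  using p_ge_3 by (intro image_eqI [of _ _ "i mod p"]) (auto simp: corner_mod)

lemma edge_point_0: "edge_point i 0 = corner D i"
  and edge_point_1: "edge_point i 1 = corner D (Suc i)"
  by (simp_all add: edge_point_def corner_eq)

lemma side_eq: "side D i = edge_point i ` {0..1}"
  unfolding side_def closed_segment_def
  by (auto simp: edge_point_def corner_eq scaleR_conv_of_real algebra_simps image_iff Bex_def)

lemma edge_point_in_side: "s \<in> {0..1} \<Longrightarrow> edge_point i s \<in> side D i"
  by (simp add: side_eq)

lemma polygon_convex: "convex (polygon D)"
  by (simp add: polygon_def)

lemma corner_in_polygon: "corner D i \<in> polygon D"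
  unfolding polygon_def using corner_in_corners by (rule hull_inc)

lemma side_subset_polygon: "side D i \<subseteq> polygon D"
  unfolding side_def
  by (intro closed_segment_subset corner_in_polygon polygon_convex)

lemma edge_point_in_polygon: "s \<in> {0..1} \<Longrightarrow> edge_point i s \<in> polygon D"
  using edge_point_in_side side_subset_polygon by blast

lemma dist_edge_point: "dist (edge_point i s) (edge_point i t) = R * \<bar>s - t\<bar> * norm (zeta - 1)"
proof -
  have "edge_point i s - edge_point i t = zeta ^ i * (of_real R * (of_real (s - t) * (zeta - 1)))"
    by (simp add: edge_point_def algebra_simps)
  then show ?thesis
    using R_pos by (simp add: dist_norm norm_mult norm_power del: of_real_diff)
qed

text \<open>Dependence on \<open>s * (1 - s)\<close> alone means that the distance to the centre
  determines the parameter on a side up to exchanging \<open>s\<close> and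
  \<open>1 - s\<close>.\<close>

lemma norm_convex_zeta:
  "(norm (of_real (1 - s) + of_real s * zeta))\<^sup>2 = 1 - 2 * s * (1 - s) * (1 - Re zeta)"
proof -
  have z: "(Re zeta)\<^sup>2 + (Im zeta)\<^sup>2 = 1"
    by (simp add: cmod_power2 [symmetric])
  have "(norm (of_real (1 - s) + of_real s * zeta))\<^sup>2 = (1 - s + s * Re zeta)\<^sup>2 + (s * Im zeta)\<^sup>2"
    by (simp add: cmod_power2)
  also have "\<dots> = (1 - s)\<^sup>2 + 2 * s * (1 - s) * Re zeta + s\<^sup>2 * ((Re zeta)\<^sup>2 + (Im zeta)\<^sup>2)"
    by (simp add: power2_eq_square algebra_simps)
  also have "\<dots> = 1 - 2 * s * (1 - s) * (1 - Re zeta)"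
    unfolding z by (simp add: power2_eq_square algebra_simps)
  finally show ?thesis .
qed

lemma norm_edge_point: "(norm (edge_point i s))\<^sup>2 = R\<^sup>2 * (1 - 2 * s * (1 - s) * (1 - Re zeta))"
  by (simp add: edge_point_def norm_mult norm_power power_mult_distrib norm_convex_zeta del: of_real_diff)

lemma norm_edge_point_eq_iff:
  "norm (edge_point i s) = norm (edge_point j t) \<longleftrightarrow> t = s \<or> t = 1 - s"
proof -
  have "norm (edge_point i s) = norm (edge_point j t) \<longleftrightarrow>
      (norm (edge_point i s))\<^sup>2 = (norm (edge_point j t))\<^sup>2"
    by (simp add: power2_eq_iff_nonneg)
  also have "\<dots> \<longleftrightarrow> s * (1 - s) = t * (1 - t)"
    using R_pos Re_zeta_less by (simp add: norm_edge_point)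
  also have "\<dots> \<longleftrightarrow> (t - s) * (t - (1 - s)) = 0"
    by (auto simp: algebra_simps)
  finally show ?thesis by simp
qed

lemma norm_edge_point_eq_R_iff: "norm (edge_point i s) = R \<longleftrightarrow> s = 0 \<or> s = 1"
  using norm_edge_point_eq_iff [of i 0 i s] by (auto simp: edge_point_0 norm_corner)

text \<open>Equal norms leave only \<open>t = s\<close> or \<open>t = 1 - s\<close>. The first case
  forces equal rotations; the second, two sides crossing symmetrically, is refuted by comparing real
  parts.\<close>

lemma edge_point_side_unique:
  assumes eq: "edge_point i s = edge_point j t" and "s \<in> {0..1}" "norm (edge_point i s) \<noteq> R"
    and ij: "i < p" "j < p"
  shows "i = j"
proof (rule ccontr)
  assume neq: "i \<noteq> j"
  have "s \<noteq> 0" "s \<noteq> 1" using assms(3) unfolding norm_edge_point_eq_R_iff by auto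
  then have s: "0 < s" "s < 1" using assms(2) by auto
  define c where "c = Re zeta"
  define a where "a = of_real (1 - s) + of_real s * zeta"
  have c2: "c * c < 1"
    using Re_zeta_less Re_zeta_greater by (simp add: c_def abs_square_less_1 flip: power2_eq_square)
  have z: "c * c + Im zeta * Im zeta = 1"
    using cmod_power2 [of zeta] by (simp add: c_def power2_eq_square)
  have norm_a: "(norm a)\<^sup>2 = (1 - s)\<^sup>2 + s\<^sup>2 + 2 * s * (1 - s) * c"
    unfolding a_def norm_convex_zeta by (simp add: c_def power2_eq_square algebra_simps)
  \<comment> \<open>The segment from 1 to \<open>zeta\<close> misses the centre: the squared norm of
    \<open>a\<close> is \<open>1 - 2 * s * (1 - s) * (1 - c)\<close>, where
    \<open>s * (1 - s) \<le> 1 / 4\<close> and \<open>1 - c < 2\<close>.\<close>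
  have sq: "s * (1 - s) > 0" using s by simp
  have "s * (1 - s) \<le> 1 / 4"
    using zero_le_power2 [of "s - 1 / 2"] by (simp add: power2_eq_square algebra_simps)
  moreover have "2 * (s * (1 - s)) * (1 - c) < 2 * (s * (1 - s)) * 2"
    using sq Re_zeta_greater by (intro mult_strict_left_mono) (auto simp: c_def)
  ultimately have "2 * (s * (1 - s)) * (1 - c) < 1" by linarith
  then have a_nz: "a \<noteq> 0"
    using norm_convex_zeta [of s] by (auto simp: a_def c_def mult_ac)
  have "t = s \<or> t = 1 - s" using eq norm_edge_point_eq_iff [of i s j t] by simp
  then show False
  proof
    assume "t = s"
    then have "zeta ^ i = zeta ^ j"
      using eq a_nz R_pos by (simp add: edge_point_def a_def)
    then show False using zeta_power_inj ij neq by blast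
  next
    assume "t = 1 - s"
    then have "zeta ^ i * a = zeta ^ j * (of_real s + of_real (1 - s) * zeta)"
      using eq R_pos by (simp add: edge_point_def a_def mult.left_commute [of _ "of_real R"])
    \<comment> \<open>The map \<open>z \<mapsto> zeta * cnj z\<close> is the reflection swapping 1
      and \<open>zeta\<close>; on the side it exchanges \<open>s\<close> and
      \<open>1 - s\<close>.\<close>
    also have "of_real s + of_real (1 - s) * zeta = zeta * cnj a"
      by (simp add: a_def distrib_left mult.left_commute [of zeta] zeta_cnj mult.commute [of zeta "1 - of_real s"])
    finally have eq':
      \<comment> \<open>hence \<open>a\<^sup>2 / \<zeta> = \<zeta> ^ (j - i) * \<bar>a\<bar>\<^sup>2\<close>, and the real parts of the two sides cannot agree\<close>
      "zeta ^ i * a = zeta ^ j * (zeta * cnj a)" .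
    define b where "b = zeta ^ j * cnj (zeta ^ i)"
    have "zeta ^ i * cnj (zeta ^ i) = 1"
      using complex_norm_square [of "zeta ^ i"] by (simp add: norm_power)
    then have "a * a * cnj zeta = (zeta ^ i * a) * (a * cnj zeta * cnj (zeta ^ i))"
      by (simp add: mult_ac)
    also have "\<dots> = b * (a * cnj a) * (zeta * cnj zeta)"
      unfolding eq' b_def by (simp only: mult_ac)
    also have "\<dots> = b * of_real ((norm a)\<^sup>2)"
      unfolding complex_norm_square zeta_cnj by simp
    finally have "Re (a * a * cnj zeta) = Re b * (norm a)\<^sup>2"
      by simp
    also have "\<dots> \<le> c * (norm a)\<^sup>2"
      unfolding c_def b_def using Re_zeta_power_quotient_le [OF ij neq] by (intro mult_right_mono zero_le_power2)
    \<comment> \<open>This value exceeds the bound \<open>c * (norm a)\<^sup>2\<close> by exactly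
      \<open>2 * s * (1 - s) * (1 - c * c)\<close>, which is positive.\<close>
    also have "Re (a * a * cnj zeta) =
        (1 - s)\<^sup>2 * c + 2 * s * (1 - s) * (c * c + Im zeta * Im zeta) + s\<^sup>2 * c * (c * c + Im zeta * Im zeta)"
      by (simp add: a_def c_def power2_eq_square algebra_simps)
    finally have "2 * (s * (1 - s)) * (1 - c * c) \<le> 0"
      unfolding z norm_a by (simp add: algebra_simps power2_eq_square)
    moreover have "0 < 2 * (s * (1 - s)) * (1 - c * c)"
      using s c2 by simp
    ultimately show False by linarith
  qed
qed

section \<open>Gluing maps and identified points\<close>

lemma gluing_rot_eq: "gluing_rot D s = - (zeta ^ snd (partner D s) / zeta ^ snd s)"
proof -
  \<comment> \<open>Partnered sides are traversed in opposite directions; this is the origin of the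
    minus sign.\<close>
  have "corner D j - corner D (Suc j) = - (of_real R * zeta ^ j * (zeta - 1))"
    "corner D (Suc i) - corner D i = of_real R * zeta ^ i * (zeta - 1)" for i j
    by (simp_all add: corner_eq algebra_simps)
  then show ?thesis
    using R_pos by (simp add: gluing_rot_def Let_def)
qed

lemma norm_gluing_rot: "norm (gluing_rot D s) = 1"
  by (simp add: gluing_rot_eq norm_divide norm_power)

lemma gluing_rot_partner: "s \<in> face_sides D \<Longrightarrow> gluing_rot D (partner D s) = inverse (gluing_rot D s)"
  by (simp add: gluing_rot_eq partner_partner)

lemma gluing_map_edge_point:
  "gluing_map D (f, i) (edge_point i s) = edge_point (snd (partner D (f, i))) (1 - s)"
proof -
  have "edge_point i s - corner D i = zeta ^ i * (of_real R * (of_real s * (zeta - 1)))"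
    by (simp add: edge_point_def corner_eq algebra_simps)
  then have "gluing_rot D (f, i) * (edge_point i s - corner D i) =
      - (zeta ^ snd (partner D (f, i)) * (of_real R * (of_real s * (zeta - 1))))"
    by (simp add: gluing_rot_eq)
  then show ?thesis
    by (simp add: gluing_map_def corner_eq edge_point_def algebra_simps)
qed

lemma glued_iff:
  "(x, y) \<in> glued D \<longleftrightarrow> (\<exists>f i g j s. (f, i) \<in> face_sides D \<and> partner D (f, i) = (g, j) \<and> s \<in> {0..1} \<and>
     x = (f, edge_point i s) \<and> y = (g, edge_point j (1 - s)))"
proof -
  have "(x, y) \<in> glued D \<longleftrightarrow> (\<exists>f i s. (f, i) \<in> face_sides D \<and> s \<in> {0..1} \<and> x = (f, edge_point i s) \<and>
     y = (fst (partner D (f, i)), gluing_map D (f, i) (edge_point i s)))"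
    unfolding glued_def side_eq by blast
  also have "\<dots> \<longleftrightarrow> (\<exists>f i s. (f, i) \<in> face_sides D \<and> s \<in> {0..1} \<and> x = (f, edge_point i s) \<and>
     (\<exists>g j. partner D (f, i) = (g, j) \<and> y = (g, edge_point j (1 - s))))"
    unfolding gluing_map_edge_point by (intro iff_exI conj_cong refl) (auto simp: prod_eq_iff)
  finally show ?thesis by blast
qed

text \<open>Both \<open>partner\<close> and the exchange of \<open>s\<close> and
  \<open>1 - s\<close> are involutions. Hence \<open>proj\<close> needs only the reflexive
  transitive closure of \<open>glued\<close>, which permits induction along gluings in one
  direction.\<close>

lemma glued_sym: "(x, y) \<in> glued D \<Longrightarrow> (y, x) \<in> glued D"
  unfolding glued_iff
proof (elim exE conjE)
  fix f i g j s
  assume *: "(f, i) \<in> face_sides D" "partner D (f, i) = (g, j)" "s \<in> {0..1}"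
    "x = (f, edge_point i s)" "y = (g, edge_point j (1 - s))"
  then have "(g, j) \<in> face_sides D" "partner D (g, j) = (f, i)"
    by (metis partner_closed, metis partner_partner)
  then show "\<exists>f i g j s. (f, i) \<in> face_sides D \<and> partner D (f, i) = (g, j) \<and> s \<in> {0..1} \<and>
      y = (f, edge_point i s) \<and> x = (g, edge_point j (1 - s))"
    using * by (intro exI [of _ g] exI [of _ j] exI [of _ f] exI [of _ i] exI [of _ "1 - s"]) auto
qed

lemma proj_eq: "proj D x = {y. (x, y) \<in> (glued D)\<^sup>*}"
proof -
  have "glued D \<union> (glued D)\<inverse> = glued D" using glued_sym by auto
  then show ?thesis by (simp add: proj_def)
qed

lemma proj_self [simp]: "x \<in> proj D x"
  by (simp add: proj_eq)

lemma proj_eqI: "y \<in> proj D x \<Longrightarrow> proj D y = proj D x"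
proof -
  have "sym (glued D)" using glued_sym by (auto intro: symI)
  then have "sym ((glued D)\<^sup>*)" by (rule sym_rtrancl)
  then show "y \<in> proj D x \<Longrightarrow> proj D y = proj D x"
    unfolding proj_eq by (auto intro: rtrancl_trans dest: symD)
qed

lemma proj_glued: "(x, y) \<in> glued D \<Longrightarrow> proj D y = proj D x"
  by (rule proj_eqI) (auto simp: proj_eq)

lemma proj_induct [consumes 1, case_names self glued]:
  assumes "y \<in> proj D x" and "P x"
    and "\<And>y z. y \<in> proj D x \<Longrightarrow> P y \<Longrightarrow> (y, z) \<in> glued D \<Longrightarrow> P z"
  shows "P y"
proof -
  have "(x, y) \<in> (glued D)\<^sup>*" using assms(1) by (simp add: proj_eq)
  then show ?thesis
    by induction (use assms(2,3) in \<open>auto simp: proj_eq\<close>)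
qed

text \<open>Exchanging \<open>s\<close> and \<open>1 - s\<close> keeps the distance to the face
  centre. This invariant separates corners from other points and keeps the sets of representatives
  finite.\<close>

lemma norm_proj: "y \<in> proj D x \<Longrightarrow> norm (snd y) = norm (snd x)"
proof (induction rule: proj_induct)
  case (glued y z)
  then obtain f i g j s where "y = (f, edge_point i s)" "z = (g, edge_point j (1 - s))"
    by (auto simp: glued_iff)
  then show ?case
    using glued.IH norm_edge_point_eq_iff [of i s j "1 - s"] by simp
qed auto

lemma proj_subset: "x \<in> faces D \<times> polygon D \<Longrightarrow> proj D x \<subseteq> faces D \<times> polygon D"
proof
  fix y assume "y \<in> proj D x" "x \<in> faces D \<times> polygon D"
  then show "y \<in> faces D \<times> polygon D"
  proof (induction rule: proj_induct)
    case (glued y z)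
    then obtain f i g j s where "(f, i) \<in> face_sides D" "partner D (f, i) = (g, j)" "s \<in> {0..1}"
        "z = (g, edge_point j (1 - s))"
      by (auto simp: glued_iff)
    then show ?case
      using partner_closed [of "(f, i)"] edge_point_in_polygon [of "1 - s" j] by (auto simp: mem_face_sides)
  qed
qed

lemma proj_cases:
  assumes "y \<in> proj D x"
  shows "y = x \<or> (\<exists>g j s. (g, j) \<in> face_sides D \<and> s \<in> {0..1} \<and> y = (g, edge_point j s))"
  using assms
proof (induction rule: proj_induct)
  case (glued y z)
  then obtain f i g j s where "(f, i) \<in> face_sides D" "partner D (f, i) = (g, j)" "s \<in> {0..1}"
      "z = (g, edge_point j (1 - s))"
    by (auto simp: glued_iff)
  then show ?case
    using partner_closed [of "(f, i)"]
    by (intro disjI2 exI [of _ g] exI [of _ j] exI [of _ "1 - s"]) auto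
qed simp

text \<open>Gluing preserves the distance to the centre, so only the parameters \<open>s\<close> and \<open>1 - s\<close> on each side occur.\<close>

lemma finite_proj: "finite (proj D x)"
proof -
  define T where "T = {s \<in> {0..1}. norm (edge_point 0 s) = norm (snd x)}"
  have "finite T"
  proof (cases "T = {}")
    case False
    then obtain s where "s \<in> T" by blast
    then have "t = s \<or> t = 1 - s" if "t \<in> T" for t
      using that norm_edge_point_eq_iff [of 0 s 0 t] by (simp add: T_def)
    then have "T \<subseteq> {s, 1 - s}" by blast
    then show ?thesis by (rule finite_subset) simp
  qed simp
  then have "finite (insert x (faces D \<times> (\<Union>j<p. edge_point j ` T)))"
    using finite_faces by simp
  moreover have "proj D x \<subseteq> insert x (faces D \<times> (\<Union>j<p. edge_point j ` T))"
  proof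
    fix y assume y: "y \<in> proj D x"
    from proj_cases [OF y] show "y \<in> insert x (faces D \<times> (\<Union>j<p. edge_point j ` T))"
    proof (elim disjE exE conjE)
      fix g j s assume *: "(g, j) \<in> face_sides D" "s \<in> {0..1}" "y = (g, edge_point j s)"
      then have "norm (edge_point 0 s) = norm (snd x)"
        using norm_proj [OF y] norm_edge_point_eq_iff [of j s 0 s] by simp
      then have "s \<in> T" "g \<in> faces D" "j \<in> {..<p}" using * by (simp_all add: mem_face_sides T_def)
      then have "(g, edge_point j s) \<in> faces D \<times> (\<Union>j<p. edge_point j ` T)" by blast
      then show ?thesis using *(3) by blast
    qed simp
  qed
  ultimately show ?thesis by (rule finite_subset [rotated])
qed

text \<open>Among points of sides only the corners have norm \<open>R\<close>, so by invariance of
  the norm nothing else is identified with a corner.\<close>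

lemma proj_in_vertices_iff:
  assumes "f \<in> faces D" shows "proj D (f, z) \<in> vertices D \<longleftrightarrow> z \<in> corner D ` {..<p}"
proof
  assume "proj D (f, z) \<in> vertices D"
  then obtain g i where gi: "proj D (f, z) = proj D (g, corner D i)" "i < p"
    by (auto simp: vertices_def face_sides_def)
  then have *: "(f, z) \<in> proj D (g, corner D i)" using proj_self by blast
  from proj_cases [OF *] show "z \<in> corner D ` {..<p}"
  proof (elim disjE exE conjE)
    fix h j s assume **: "(h, j) \<in> face_sides D" "s \<in> {0..1}" "(f, z) = (h, edge_point j s)"
    then have "norm (edge_point j s) = R"
      using norm_proj [OF *] by (simp add: norm_corner)
    then have "s = 0 \<or> s = 1" by (simp add: norm_edge_point_eq_R_iff)
    then show ?thesis
      using **(3) corner_in_corners by (elim disjE) (simp_all add: edge_point_0 edge_point_1)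
  qed (use gi in auto)
qed (use assms in \<open>auto simp: vertices_def face_sides_def\<close>)

section \<open>Topology of the surface and stars of points\<close>

lemma topspace_surface: "topspace (surface D) = proj D ` (faces D \<times> polygon D)"
  by (simp add: surface_def disjoint_polygons_def)

lemma surface_pointE:
  assumes "x \<in> topspace (surface D)"
  obtains f z where "x = proj D (f, z)" "f \<in> faces D" "z \<in> polygon D"
  using assms by (auto simp: topspace_surface)

lemma surface_point_rep:
  assumes "x \<in> topspace (surface D)" "r \<in> x"
  shows "x = proj D r" "fst r \<in> faces D" "snd r \<in> polygon D"
proof -
  obtain f z where *: "x = proj D (f, z)" "f \<in> faces D" "z \<in> polygon D"
    using assms(1) by (rule surface_pointE)
  then show "x = proj D r" using proj_eqI assms(2) by auto
  show "fst r \<in> faces D" "snd r \<in> polygon D"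
    using proj_subset [of "(f, z)"] * assms(2) by auto
qed

lemma finite_surface_point: "x \<in> topspace (surface D) \<Longrightarrow> finite x"
  by (auto simp: topspace_surface finite_proj)

lemma surface_point_nonempty: "x \<in> topspace (surface D) \<Longrightarrow> \<exists>r. r \<in> x"
  by (metis surface_pointE proj_self)

lemma surface_point_glued:
  assumes "x \<in> topspace (surface D)" "r \<in> x" "(r, r') \<in> glued D" shows "r' \<in> x"
  using surface_point_rep(1) [OF assms(1,2)] proj_glued [OF assms(3)] proj_self by blast

lemma quotient_map_proj: "quotient_map (disjoint_polygons D) (surface D) (proj D)"
  unfolding surface_def by (rule quotient_map_quotient_topology)

lemma openin_surface_iff:
  "openin (surface D) W \<longleftrightarrow> W \<subseteq> topspace (surface D) \<and>
     openin (disjoint_polygons D) {r \<in> faces D \<times> polygon D. proj D r \<in> W}"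
  unfolding surface_def openin_quotient_topology by (simp add: disjoint_polygons_def)

lemma openin_nonvertices: "openin (surface D) (topspace (surface D) - vertices D)"
proof -
  have "{r \<in> faces D \<times> polygon D. proj D r \<in> topspace (surface D) - vertices D} =
      faces D \<times> (polygon D \<inter> - corner D ` {..<p})"
    using proj_in_vertices_iff by (auto simp: topspace_surface)
  moreover have "openin (top_of_set (polygon D)) (polygon D \<inter> - corner D ` {..<p})"
    by (intro openin_open_Int open_Compl finite_imp_closed) simp
  ultimately show ?thesis
    unfolding openin_surface_iff by (auto simp: disjoint_polygons_def openin_prod_Times_iff)
qed

lemma locally_path_connected_surface: "locally_path_connected_space (surface D)"
  by (rule locally_path_connected_space_quotient_map_image [OF quotient_map_proj])
    (simp add: disjoint_polygons_def locally_path_connected_space_prod_topology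
      locally_path_connected_space_discrete_topology locally_path_connected_space_convex polygon_convex)

lemma locally_path_connected_punctured_surface: "locally_path_connected_space (punctured_surface D)"
  unfolding punctured_surface_def
  by (intro locally_path_connected_space_open_subset locally_path_connected_surface openin_nonvertices)

lemma topspace_punctured_surface:
  "topspace (punctured_surface D) = topspace (surface D) - vertices D"
  by (auto simp: punctured_surface_def)

lemma pathin_punctured_imp_surface: "pathin (punctured_surface D) \<gamma> \<Longrightarrow> pathin (surface D) \<gamma>"
  by (simp add: punctured_surface_def pathin_subtopology)

lemma pathin_in_face:
  assumes "f \<in> faces D" "path g" "path_image g \<subseteq> polygon D"
  shows "pathin (surface D) (\<lambda>t. proj D (f, g t))"
proof -
  have "pathin (top_of_set (polygon D)) g"
    using assms by (auto simp: pathin_canon_iff path_image_def)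
  then have "pathin (disjoint_polygons D) (\<lambda>t. (f, g t))"
    using assms(1) by (simp add: disjoint_polygons_def pathin_def continuous_map_pairedI)
  then show ?thesis
    using pathin_compose [OF _ quotient_imp_continuous_map [OF quotient_map_proj]] by (simp add: o_def)
qed

text \<open>One pair of nearby representatives suffices here; for admissible radii
  \<open>star_rep\<close> extends the closeness to every representative of \<open>y\<close>.\<close>

definition star :: "('f \<times> complex) set \<Rightarrow> real \<Rightarrow> ('f \<times> complex) set set" where
  "star x \<epsilon> = {y \<in> topspace (surface D). \<exists>f z w. (f, z) \<in> x \<and> (f, w) \<in> y \<and> dist w z < \<epsilon>}"

text \<open>
  For such a radius the discs around the representatives of \<open>x\<close> are disjoint within each face and
  meet only sides through their centres. Hence gluing maps permute their intersections with the
  sides, and the star is open also when \<open>x\<close> is a vertex.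
\<close>

definition star_radius :: "('f \<times> complex) set \<Rightarrow> real \<Rightarrow> bool" where
  "star_radius x \<epsilon> \<longleftrightarrow> \<epsilon> > 0 \<and>
     (\<forall>(f, z)\<in>x. \<forall>j<p. \<forall>w\<in>side D j. dist w z < \<epsilon> \<longrightarrow> z \<in> side D j) \<and>
     (\<forall>(f, z)\<in>x. \<forall>(g, w)\<in>x. dist z w < 2 * \<epsilon> \<longrightarrow> z = w)"

text \<open>There are finitely many representatives and finitely many closed sides. Each single
  condition holds for all small radii, so all of them hold eventually at 0 from the right.\<close>

lemma star_radius_exists:
  assumes x: "x \<in> topspace (surface D)" and "\<delta> > 0"
  obtains \<epsilon> where "star_radius x \<epsilon>" "\<epsilon> \<le> \<delta>"
proof -
  have less: "\<forall>\<^sub>F \<epsilon> in at_right (0::real). \<epsilon> < e" if "e > 0" for e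
    using that by (auto simp: eventually_at_right)
  have 1: "\<forall>\<^sub>F \<epsilon> in at_right 0. \<forall>r\<in>x. \<forall>j\<in>{..<p}.
      (\<exists>w\<in>side D j. dist w (snd r) < \<epsilon>) \<longrightarrow> snd r \<in> side D j"
  proof (intro eventually_ball_finite ballI)
    fix r j
    show "\<forall>\<^sub>F \<epsilon> in at_right 0. (\<exists>w\<in>side D j. dist w (snd r) < \<epsilon>) \<longrightarrow> snd r \<in> side D j"
    proof (cases "snd r \<in> side D j")
      case False
      then obtain e where "e > 0" "\<And>w. w \<in> side D j \<Longrightarrow> e \<le> dist (snd r) w"
        using separate_point_closed [of "side D j" "snd r"] by (auto simp: side_def)
      then have "(\<exists>w\<in>side D j. dist w (snd r) < \<epsilon>) \<longrightarrow> snd r \<in> side D j" if "\<epsilon> < e" for \<epsilon>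
        using that by (fastforce simp: dist_commute)
      then show ?thesis by (rule eventually_mono [OF less [OF \<open>e > 0\<close>]])
    qed simp
  qed (use finite_surface_point [OF x] in auto)
  have 2: "\<forall>\<^sub>F \<epsilon> in at_right 0. \<forall>r\<in>x. \<forall>r'\<in>x. dist (snd r) (snd r') < 2 * \<epsilon> \<longrightarrow> snd r = snd r'"
  proof (intro eventually_ball_finite ballI)
    fix r r' :: "'f \<times> complex"
    show "\<forall>\<^sub>F \<epsilon> in at_right 0. dist (snd r) (snd r') < 2 * \<epsilon> \<longrightarrow> snd r = snd r'"
      using less [of "dist (snd r) (snd r') / 2"]
      by (cases "snd r = snd r'") (auto elim: eventually_mono)
  qed (use finite_surface_point [OF x] in auto)
  have "\<forall>\<^sub>F \<epsilon> in at_right (0::real). star_radius x \<epsilon> \<and> \<epsilon> < \<delta>"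
    using 1 2 less [OF assms(2)] eventually_at_right_less
    by eventually_elim (fastforce simp: star_radius_def)
  then obtain \<epsilon> where "star_radius x \<epsilon> \<and> \<epsilon> < \<delta>"
    using eventually_happens' trivial_limit_at_right_real by blast
  then show thesis using that by auto
qed

text \<open>A side that meets the disc passes through its centre. So the gluing map also applies to
  the centre, and along the side it preserves distances.\<close>

lemma glued_near:
  assumes x: "x \<in> topspace (surface D)" and \<epsilon>: "star_radius x \<epsilon>"
    and side: "(f, i) \<in> face_sides D" "s \<in> {0..1}"
    and z: "(f, z) \<in> x" "dist (edge_point i s) z < \<epsilon>"
  shows "z \<in> side D i"
    "(fst (partner D (f, i)), gluing_map D (f, i) z) \<in> x"
    "dist (gluing_map D (f, i) (edge_point i s)) (gluing_map D (f, i) z) < \<epsilon>"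
proof -
  show zi: "z \<in> side D i"
    using \<epsilon> side z edge_point_in_side unfolding star_radius_def
    by (fastforce simp: mem_face_sides)
  then obtain t where t: "t \<in> {0..1}" "z = edge_point i t" by (auto simp: side_eq)
  show "dist (gluing_map D (f, i) (edge_point i s)) (gluing_map D (f, i) z) < \<epsilon>"
    using z(2) by (simp add: t(2) gluing_map_edge_point dist_edge_point abs_minus_commute)
  have "((f, z), (fst (partner D (f, i)), gluing_map D (f, i) z)) \<in> glued D"
    using side(1) zi by (auto simp: glued_def)
  then show "(fst (partner D (f, i)), gluing_map D (f, i) z) \<in> x"
    using surface_point_glued [OF x z(1)] by blast
qed

text \<open>Closeness to a representative of \<open>x\<close> is propagated along a chain of gluings
  by \<open>glued_near\<close>.\<close>

lemma star_rep:
  assumes x: "x \<in> topspace (surface D)" and \<epsilon>: "star_radius x \<epsilon>"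
    and y: "y \<in> star x \<epsilon>" "(f, w) \<in> y"
  shows "\<exists>z. (f, z) \<in> x \<and> dist w z < \<epsilon>"
proof -
  obtain f0 z0 w0 where *: "(f0, z0) \<in> x" "(f0, w0) \<in> y" "dist w0 z0 < \<epsilon>"
    and yt: "y \<in> topspace (surface D)"
    using y by (auto simp: star_def)
  have "(f, w) \<in> proj D (f0, w0)"
    using surface_point_rep(1) [OF yt *(2)] y(2) by simp
  then have "\<exists>z. (fst (f, w), z) \<in> x \<and> dist (snd (f, w)) z < \<epsilon>"
  proof (induction rule: proj_induct)
    case self
    then show ?case using * by auto
  next
    case (glued a b)
    then obtain g i s where a: "a = (g, edge_point i s)" "(g, i) \<in> face_sides D" "s \<in> {0..1}"
        and b: "b = (fst (partner D (g, i)), edge_point (snd (partner D (g, i))) (1 - s))"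
      by (auto simp: glued_iff)
    with glued obtain z where "(g, z) \<in> x" "dist (edge_point i s) z < \<epsilon>" by auto
    then show ?case
      using glued_near [OF x \<epsilon> a(2,3)] unfolding b gluing_map_edge_point by fastforce
  qed
  then show ?thesis by simp
qed

text \<open>By \<open>star_rep\<close> the preimage in the polygons is just the union of the
  relative discs around the representatives of \<open>x\<close>.\<close>

lemma openin_star:
  assumes x: "x \<in> topspace (surface D)" and \<epsilon>: "star_radius x \<epsilon>"
  shows "openin (surface D) (star x \<epsilon>)"
proof -
  have "{r \<in> faces D \<times> polygon D. proj D r \<in> star x \<epsilon>} =
      (\<Union>(f, z)\<in>x. {f} \<times> (polygon D \<inter> ball z \<epsilon>))" (is "?L = ?R")
  proof (intro equalityI subsetI)
    fix r assume r: "r \<in> ?L"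
    then obtain f w where fw: "r = (f, w)" "f \<in> faces D" "w \<in> polygon D" "proj D (f, w) \<in> star x \<epsilon>"
      by auto
    obtain z where "(f, z) \<in> x" "dist w z < \<epsilon>"
      using star_rep [OF x \<epsilon> fw(4) proj_self] by blast
    then show "r \<in> ?R" using fw by (auto simp: dist_commute)
  next
    fix r assume "r \<in> ?R"
    then obtain f z w where r: "r = (f, w)" "(f, z) \<in> x" "w \<in> polygon D" "dist w z < \<epsilon>"
      by (auto simp: dist_commute)
    then have "f \<in> faces D" using surface_point_rep(2) [OF x r(2)] by simp
    then show "r \<in> ?L"
      using r proj_self unfolding star_def topspace_surface by blast
  qed
  moreover have "openin (disjoint_polygons D) (\<Union>(f, z)\<in>x. {f} \<times> (polygon D \<inter> ball z \<epsilon>))"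
  proof (intro openin_Union ballI, clarify)
    fix f z assume "(f, z) \<in> x"
    then have "f \<in> faces D" using surface_point_rep(2) [OF x] by fastforce
    then show "openin (disjoint_polygons D) ({f} \<times> (polygon D \<inter> ball z \<epsilon>))"
      by (simp add: disjoint_polygons_def openin_prod_Times_iff openin_open_Int)
  qed
  ultimately show ?thesis
    unfolding openin_surface_iff by (auto simp: star_def)
qed

lemma star_self:
  assumes "x \<in> topspace (surface D)" "\<epsilon> > 0" shows "x \<in> star x \<epsilon>"
  using surface_point_nonempty [OF assms(1)] assms by (force simp: star_def)

lemma pathin_stays_in_star:
  assumes \<gamma>: "pathin (surface D) \<gamma>" and t: "t \<in> {0..1}" and \<epsilon>: "star_radius (\<gamma> t) \<epsilon>"
  obtains d where "d > 0" "\<And>s. s \<in> {0..1} \<Longrightarrow> \<bar>s - t\<bar> < d \<Longrightarrow> \<gamma> s \<in> star (\<gamma> t) \<epsilon>"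
proof -
  have "\<gamma> t \<in> topspace (surface D)" using pathin_into_topspace \<gamma> t by metis
  then show thesis
    using that pathin_openin_preimage [OF \<gamma> openin_star t star_self] \<epsilon>
    by (auto simp: star_radius_def)
qed

section \<open>Parallel transport\<close>

text \<open>A unit tangent vector at \<open>x\<close>, given by its coordinates in all faces
  containing \<open>x\<close>: the first two clauses of \<open>parallel_along\<close> at a single
  time.\<close>

definition frame :: "('f \<times> complex) set \<Rightarrow> ('f \<times> complex \<Rightarrow> complex) \<Rightarrow> bool" where
  "frame x u \<longleftrightarrow> (\<forall>r\<in>x. norm (u r) = 1) \<and>
     (\<forall>f i z. (f, i) \<in> face_sides D \<and> (f, z) \<in> x \<and> z \<in> side D i \<longrightarrow>
        u (fst (partner D (f, i)), gluing_map D (f, i) z) = gluing_rot D (f, i) * u (f, z))"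

text \<open>The third clause of \<open>parallel_along\<close> on an arbitrary interval, so that
  fields can be built by subdivision and quotients and powers of fields can be treated
  alike.\<close>

definition locally_constant ::
    "real \<Rightarrow> real \<Rightarrow> (real \<Rightarrow> ('f \<times> complex) set) \<Rightarrow> (real \<Rightarrow> 'f \<times> complex \<Rightarrow> complex) \<Rightarrow> bool" where
  "locally_constant a b \<gamma> U \<longleftrightarrow>
     (\<forall>t\<in>{a..b}. \<forall>(f, z)\<in>\<gamma> t. \<exists>\<epsilon>>0. \<forall>t'\<in>{a..b}. \<forall>z'.
        \<bar>t' - t\<bar> < \<epsilon> \<and> dist z' z < \<epsilon> \<and> (f, z') \<in> \<gamma> t' \<longrightarrow> U t' (f, z') = U t (f, z))"

definition parallel_on ::
    "real \<Rightarrow> real \<Rightarrow> (real \<Rightarrow> ('f \<times> complex) set) \<Rightarrow> (real \<Rightarrow> 'f \<times> complex \<Rightarrow> complex) \<Rightarrow> bool" where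
  "parallel_on a b \<gamma> U \<longleftrightarrow> (\<forall>t\<in>{a..b}. frame (\<gamma> t) (U t)) \<and> locally_constant a b \<gamma> U"

lemma parallel_along_iff: "parallel_along D \<gamma> U \<longleftrightarrow> parallel_on 0 1 \<gamma> U"
  unfolding parallel_along_def parallel_on_def frame_def locally_constant_def by blast

lemma locally_constantD:
  assumes "locally_constant a b \<gamma> U" "t \<in> {a..b}" "(f, z) \<in> \<gamma> t"
  obtains \<epsilon> where "\<epsilon> > 0"
    "\<And>t' z'. t' \<in> {a..b} \<Longrightarrow> \<bar>t' - t\<bar> < \<epsilon> \<Longrightarrow> dist z' z < \<epsilon> \<Longrightarrow> (f, z') \<in> \<gamma> t' \<Longrightarrow>
      U t' (f, z') = U t (f, z)"
proof -
  have "\<exists>\<epsilon>>0. \<forall>t'\<in>{a..b}. \<forall>z'. \<bar>t' - t\<bar> < \<epsilon> \<and> dist z' z < \<epsilon> \<and> (f, z') \<in> \<gamma> t' \<longrightarrow>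
      U t' (f, z') = U t (f, z)"
    using bspec [OF bspec [OF assms(1) [unfolded locally_constant_def] assms(2)] assms(3)]
    by (simp only: prod.case)
  then show thesis using that by blast
qed

lemma locally_constantI:
  assumes "\<And>t f z. t \<in> {a..b} \<Longrightarrow> (f, z) \<in> \<gamma> t \<Longrightarrow>
    \<exists>\<epsilon>>0. \<forall>t'\<in>{a..b}. \<forall>z'. \<bar>t' - t\<bar> < \<epsilon> \<and> dist z' z < \<epsilon> \<and> (f, z') \<in> \<gamma> t' \<longrightarrow>
      U t' (f, z') = U t (f, z)"
  shows "locally_constant a b \<gamma> U"
  unfolding locally_constant_def
proof (intro ballI)
  fix t r assume *: "t \<in> {a..b}" "r \<in> \<gamma> t"
  obtain f z where r: "r = (f, z)" by (cases r)
  show "case r of (f, z) \<Rightarrow> \<exists>\<epsilon>>0. \<forall>t'\<in>{a..b}. \<forall>z'.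
      \<bar>t' - t\<bar> < \<epsilon> \<and> dist z' z < \<epsilon> \<and> (f, z') \<in> \<gamma> t' \<longrightarrow> U t' (f, z') = U t (f, z)"
    unfolding r prod.case using * by (intro assms) (simp_all add: r)
qed

lemma frame_norm: "frame x u \<Longrightarrow> r \<in> x \<Longrightarrow> norm (u r) = 1"
  by (simp add: frame_def)

lemma frame_nonzero: "frame x u \<Longrightarrow> r \<in> x \<Longrightarrow> u r \<noteq> 0"
  using frame_norm [of x u r] by auto

lemma frame_glue:
  "frame x u \<Longrightarrow> (f, i) \<in> face_sides D \<Longrightarrow> (f, z) \<in> x \<Longrightarrow> z \<in> side D i \<Longrightarrow>
     u (fst (partner D (f, i)), gluing_map D (f, i) z) = gluing_rot D (f, i) * u (f, z)"
  by (simp add: frame_def)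

lemma gluing_rot_nonzero: "gluing_rot D s \<noteq> 0"
  using norm_gluing_rot [of s] by auto

lemma glue_in_point:
  assumes "x \<in> topspace (surface D)" "(f, i) \<in> face_sides D" "(f, z) \<in> x" "z \<in> side D i"
  shows "(fst (partner D (f, i)), gluing_map D (f, i) z) \<in> x"
proof -
  have "((f, z), (fst (partner D (f, i)), gluing_map D (f, i) z)) \<in> glued D"
    unfolding glued_def using assms by blast
  then show ?thesis by (rule surface_point_glued [OF assms(1,3)])
qed

lemma glue_invariant_constant:
  assumes x: "x \<in> topspace (surface D)" "r \<in> x" "r' \<in> x"
    and G: "\<And>f i z. (f, i) \<in> face_sides D \<Longrightarrow> (f, z) \<in> x \<Longrightarrow> z \<in> side D i \<Longrightarrow>
      G (fst (partner D (f, i)), gluing_map D (f, i) z) = G (f, z)"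
  shows "G r' = G r"
proof -
  have xr: "x = proj D r" using surface_point_rep x by blast
  with x(3) have "r' \<in> proj D r" by simp
  then show ?thesis
  proof (induction rule: proj_induct)
    case (glued y z)
    then obtain f i w where *: "y = (f, w)" "z = (fst (partner D (f, i)), gluing_map D (f, i) w)"
        "(f, i) \<in> face_sides D" "w \<in> side D i"
      by (auto simp: glued_def)
    then show ?case using G [of f i w] glued by (simp add: xr)
  qed simp
qed

text \<open>At each gluing both frames acquire the same nonzero rotation, which cancels in the
  quotient.\<close>

lemma frame_ratio:
  assumes x: "x \<in> topspace (surface D)" "r \<in> x" "r' \<in> x" and "frame x u" "frame x v"
  shows "u r' / v r' = u r / v r"
  by (rule glue_invariant_constant [OF x, where G = "\<lambda>r. u r / v r"])
    (simp add: frame_glue [OF assms(4)] frame_glue [OF assms(5)] gluing_rot_nonzero)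

text \<open>Gluing invariance turns \<open>G\<close> into a function of time alone, and bisection
  makes a locally constant function of time constant. Applied to the quotient of two parallel fields
  and to a power of one field.\<close>

lemma locally_constant_invariant_constant:
  assumes \<gamma>: "pathin (surface D) \<gamma>" and lc: "locally_constant 0 1 \<gamma> G"
    and G: "\<And>t f i z. t \<in> {0..1} \<Longrightarrow> (f, i) \<in> face_sides D \<Longrightarrow> (f, z) \<in> \<gamma> t \<Longrightarrow> z \<in> side D i \<Longrightarrow>
      G t (fst (partner D (f, i)), gluing_map D (f, i) z) = G t (f, z)"
    and r: "r \<in> \<gamma> 0" "s \<in> \<gamma> 1"
  shows "G 1 s = G 0 r"
proof -
  define g where "g t = G t (SOME r. r \<in> \<gamma> t)" for t
  have top: "\<gamma> t \<in> topspace (surface D)" if "t \<in> {0..1}" for t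
    using pathin_into_topspace \<gamma> that by metis
  have g: "G t r = g t" if t: "t \<in> {0..1}" "r \<in> \<gamma> t" for t r
    unfolding g_def
    by (rule glue_invariant_constant [OF top]) (use t G someI [of "\<lambda>r. r \<in> \<gamma> t"] in auto)
  have "0 \<le> (0::real) \<and> (1::real) \<le> 1 \<longrightarrow> g 0 = g 1"
  proof (rule Bolzano [where P = "\<lambda>a b. 0 \<le> a \<and> b \<le> 1 \<longrightarrow> g a = g b"])
    fix t :: real assume "0 \<le> t" "t \<le> 1"
    then have t: "t \<in> {0..1}" by simp
    have "\<exists>\<epsilon>>0. \<forall>t'\<in>{0..1}. \<forall>z'. \<bar>t' - t\<bar> < \<epsilon> \<longrightarrow> dist z' (snd r) < \<epsilon> \<longrightarrow> (fst r, z') \<in> \<gamma> t' \<longrightarrow>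
        G t' (fst r, z') = G t r" if "r \<in> \<gamma> t" for r
    proof -
      have "(fst r, snd r) \<in> \<gamma> t" using that by simp
      from locally_constantD [OF lc t this] show ?thesis by (metis prod.collapse)
    qed
    then obtain e where e: "\<And>r. r \<in> \<gamma> t \<Longrightarrow> e r > (0::real)"
      "\<And>r t' z'. r \<in> \<gamma> t \<Longrightarrow> t' \<in> {0..1} \<Longrightarrow> \<bar>t' - t\<bar> < e r \<Longrightarrow> dist z' (snd r) < e r \<Longrightarrow>
         (fst r, z') \<in> \<gamma> t' \<Longrightarrow> G t' (fst r, z') = G t r"
      by metis
    \<comment> \<open>The representatives of \<open>\<gamma> t\<close> are finite in number, so one
      tolerance serves them all. A star of radius at most \<open>\<delta>\<close> then supplies a
      representative of \<open>\<gamma> s\<close> within it.\<close>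
    define \<delta> where "\<delta> = Min (e ` \<gamma> t)"
    have fin: "finite (\<gamma> t)" "\<gamma> t \<noteq> {}"
      using finite_surface_point [OF top [OF t]] surface_point_nonempty [OF top [OF t]] by auto
    then have \<delta>: "\<delta> > 0" "\<And>r. r \<in> \<gamma> t \<Longrightarrow> \<delta> \<le> e r"
      using e(1) by (auto simp: \<delta>_def)
    obtain \<epsilon> where \<epsilon>: "star_radius (\<gamma> t) \<epsilon>" "\<epsilon> \<le> \<delta>"
      using star_radius_exists [OF top [OF t] \<delta>(1)] .
    obtain d where d: "d > 0" "\<And>s. s \<in> {0..1} \<Longrightarrow> \<bar>s - t\<bar> < d \<Longrightarrow> \<gamma> s \<in> star (\<gamma> t) \<epsilon>"
      using pathin_stays_in_star [OF \<gamma> t \<epsilon>(1)] by blast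
    have near: "g s = g t" if s: "s \<in> {0..1}" "\<bar>s - t\<bar> < min d \<delta>" for s
    proof -
      have "\<gamma> s \<in> star (\<gamma> t) \<epsilon>" using d(2) s by simp
      then obtain f z w where "(f, z) \<in> \<gamma> t" "(f, w) \<in> \<gamma> s" "dist w z < \<epsilon>"
        by (auto simp: star_def)
      then have "G s (f, w) = G t (f, z)"
        using e(2) [of "(f, z)" s w] \<delta>(2) [of "(f, z)"] \<epsilon>(2) s by auto
      then show ?thesis
        using g [OF s(1) \<open>(f, w) \<in> \<gamma> s\<close>] g [OF t \<open>(f, z) \<in> \<gamma> t\<close>] by simp
    qed
    show "\<exists>d>0. \<forall>a b. a \<le> t \<and> t \<le> b \<and> b - a < d \<longrightarrow> 0 \<le> a \<and> b \<le> 1 \<longrightarrow> g a = g b"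
    proof (intro exI [of _ "min d \<delta>"] conjI allI impI)
      fix a b assume "a \<le> t \<and> t \<le> b \<and> b - a < min d \<delta>" "0 \<le> a \<and> b \<le> 1"
      then show "g a = g b" using near [of a] near [of b] by auto
    qed (use d \<delta> in auto)
  qed auto
  then show ?thesis using g [of 1 s] g [of 0 r] r by simp
qed

section \<open>Existence of parallel fields\<close>

lemma side_unique:
  assumes "z \<in> side D i" "z \<in> side D j" "i < p" "j < p" "z \<notin> corner D ` {..<p}"
  shows "i = j"
proof -
  obtain s t where st: "s \<in> {0..1}" "z = edge_point i s" "z = edge_point j t"
    using assms(1,2) by (auto simp: side_eq)
  have "norm z \<noteq> R"
  proof
    assume "norm z = R"
    then have "s = 0 \<or> s = 1" using st(2) norm_edge_point_eq_R_iff by simp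
    then show False
      using st(2) assms(5) corner_in_corners by (elim disjE) (simp_all add: edge_point_0 edge_point_1)
  qed
  then show ?thesis
    using edge_point_side_unique [of i s j t] st assms(3,4) by simp
qed

lemma gluing_map_in_side: "z \<in> side D i \<Longrightarrow> gluing_map D (f, i) z \<in> side D (snd (partner D (f, i)))"
  by (auto simp: side_eq gluing_map_edge_point)

lemma gluing_map_partner:
  assumes "(f, i) \<in> face_sides D" "z \<in> side D i"
  shows "gluing_map D (partner D (f, i)) (gluing_map D (f, i) z) = z"
proof -
  obtain s where s: "z = edge_point i s" using assms(2) by (auto simp: side_eq)
  obtain g j where gj: "partner D (f, i) = (g, j)" by fastforce
  then have "partner D (g, j) = (f, i)" using partner_partner [OF assms(1)] by simp
  then show ?thesis by (simp add: s gluing_map_edge_point gj)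
qed

text \<open>Away from vertices there are one or two representatives, so only one gluing and its
  inverse have to be compatible. At a vertex the rotations met on the way around need not multiply
  to 1.\<close>

lemma frame_exists:
  assumes x: "x \<in> topspace (surface D)" "x \<notin> vertices D"
  obtains u where "frame x u"
proof -
  obtain f0 z0 where x0: "x = proj D (f0, z0)" "f0 \<in> faces D"
    using x(1) by (rule surface_pointE)
  have noncorner: "z \<notin> corner D ` {..<p}" if "(f, z) \<in> x" for f z
    using surface_point_rep [OF x(1) that] x(2) proj_in_vertices_iff [of f z] by auto
  show thesis
  proof (cases "\<exists>i<p. z0 \<in> side D i")
    case False
    have "x = {(f0, z0)}"
    proof (intro equalityI subsetI)
      fix y assume "y \<in> x"
      then have "y \<in> proj D (f0, z0)" by (simp add: x0)
      then show "y \<in> {(f0, z0)}"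
      proof (induction rule: proj_induct)
        case (glued y z)
        then show ?case using False by (auto simp: glued_def mem_face_sides)
      qed simp
    qed (simp add: x0)
    then have "frame x (\<lambda>_. 1)"
      using False by (auto simp: frame_def mem_face_sides)
    then show thesis by (rule that)
  next
    case True
    then obtain i0 where i0: "i0 < p" "z0 \<in> side D i0" by blast
    then have s0: "(f0, i0) \<in> face_sides D" using x0 by (simp add: mem_face_sides)
    obtain g j where gj: "partner D (f0, i0) = (g, j)" by fastforce
    define z1 where "z1 = gluing_map D (f0, i0) z0"
    have s1: "(g, j) \<in> face_sides D" and gj': "partner D (g, j) = (f0, i0)"
      using partner_closed [OF s0] partner_partner [OF s0] gj by simp_all
    have z1: "z1 \<in> side D j" "gluing_map D (g, j) z1 = z0"
      using gluing_map_in_side [OF i0(2), of f0] gluing_map_partner [OF s0 i0(2)] gj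
      by (simp_all add: z1_def)
    have in_x: "(f0, z0) \<in> x" "(g, z1) \<in> x"
      using glue_in_point [OF x(1) s0 _ i0(2)] by (simp_all add: x0 gj z1_def)
    have side0: "i = i0" if "(f0, i) \<in> face_sides D" "z0 \<in> side D i" for i
      using side_unique that i0 noncorner [OF in_x(1)] by (auto simp: mem_face_sides)
    have side1: "i = j" if "(g, i) \<in> face_sides D" "z1 \<in> side D i" for i
      using side_unique that z1 s1 noncorner [OF in_x(2)] by (auto simp: mem_face_sides)
    \<comment> \<open>If both representatives coincided, uniqueness of the side through the point
      would make that side its own partner.\<close>
    have neq: "(f0, z0) \<noteq> (g, z1)"
    proof
      assume "(f0, z0) = (g, z1)"
      then have "j = i0" using side0 [of j] s1 z1 by simp
      then show False using partner_neq [OF s0] gj \<open>(f0, z0) = (g, z1)\<close> by simp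
    qed
    have two: "y = (f0, z0) \<or> y = (g, z1)" if "y \<in> x" for y
    proof -
      from that have "y \<in> proj D (f0, z0)" by (simp add: x0)
      then show ?thesis
      proof (induction rule: proj_induct)
        case (glued y y')
        then obtain f i w where *: "y = (f, w)" "y' = (fst (partner D (f, i)), gluing_map D (f, i) w)"
            "(f, i) \<in> face_sides D" "w \<in> side D i"
          by (auto simp: glued_def)
        from glued.IH show ?case
        proof
          assume "y = (f0, z0)"
          then show ?thesis using * side0 [of i] by (simp add: gj z1_def)
        next
          assume "y = (g, z1)"
          then show ?thesis using * side1 [of i] by (simp add: gj' z1)
        qed
      qed simp
    qed
    define u where "u r = (if r = (f0, z0) then 1 else gluing_rot D (f0, i0))" for r
    have u: "u (f0, z0) = 1" "u (g, z1) = gluing_rot D (f0, i0)"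
      using neq by (auto simp: u_def)
    have "frame x u"
      unfolding frame_def
    proof (intro conjI ballI allI impI; (elim conjE)?)
      fix f i z assume *: "(f, i) \<in> face_sides D" "(f, z) \<in> x" "z \<in> side D i"
      from two [OF *(2)]
      show "u (fst (partner D (f, i)), gluing_map D (f, i) z) = gluing_rot D (f, i) * u (f, z)"
      proof
        assume "(f, z) = (f0, z0)"
        then show ?thesis using * side0 [of i] by (simp add: gj u flip: z1_def)
      next
        assume "(f, z) = (g, z1)"
        then show ?thesis
          using * side1 [of i] gluing_rot_partner [OF s0] gluing_rot_nonzero [of "(f0, i0)"]
          by (simp add: gj gj' u z1)
      qed
    qed (simp add: u_def norm_gluing_rot)
    then show thesis by (rule that)
  qed
qed

text \<open>The frame at the centre is copied to all nearby representatives. By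
  \<open>glued_near\<close> every gluing at a nearby point is also a gluing at the centre, with the
  same rotation.\<close>

lemma local_parallel_field:
  assumes x: "x \<in> topspace (surface D)" "x \<notin> vertices D" and \<epsilon>: "star_radius x \<epsilon>"
    and \<gamma>: "\<And>t. t \<in> {a..b} \<Longrightarrow> \<gamma> t \<in> star x \<epsilon>"
  obtains U where "parallel_on a b \<gamma> U"
proof -
  obtain u where u: "frame x u" using frame_exists [OF x] .
  \<comment> \<open>Unambiguous: two candidates would be at distance less than
    \<open>2 * \<epsilon>\<close>, which \<open>star_radius\<close> excludes unless they are
    equal.\<close>
  define near where "near f w = (SOME z. (f, z) \<in> x \<and> dist w z < \<epsilon>)" for f w
  have near: "near f w = z" if "(f, z) \<in> x" "dist w z < \<epsilon>" for f z w
    unfolding near_def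
  proof (rule some_equality)
    fix z' assume z': "(f, z') \<in> x \<and> dist w z' < \<epsilon>"
    then have "dist z' z < 2 * \<epsilon>"
      using that(2) dist_triangle2 [of z' z w] by (simp add: dist_commute)
    then show "z' = z"
      using \<epsilon> z' that(1) unfolding star_radius_def by blast
  qed (use that in simp)
  define U where "U t r = u (fst r, near (fst r) (snd r))" for t :: real and r
  have U: "U t (f, w) = u (f, z)" if "(f, z) \<in> x" "dist w z < \<epsilon>" for f z w t
    using near [OF that] by (simp add: U_def)
  have rep: "\<exists>z. (f, z) \<in> x \<and> dist w z < \<epsilon>" if "t \<in> {a..b}" "(f, w) \<in> \<gamma> t" for t f w
    using star_rep [OF x(1) \<epsilon> \<gamma> [OF that(1)] that(2)] .
  have "frame (\<gamma> t) (U t)" if t: "t \<in> {a..b}" for t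
    unfolding frame_def
  proof (intro conjI ballI allI impI; (elim conjE)?)
    fix r assume "r \<in> \<gamma> t"
    then obtain z where "(fst r, z) \<in> x" "dist (snd r) z < \<epsilon>"
      using rep [OF t, of "fst r" "snd r"] by auto
    then show "norm (U t r) = 1"
      using U [of "fst r" z "snd r" t] frame_norm [OF u] by simp
  next
    fix f i w assume *: "(f, i) \<in> face_sides D" "(f, w) \<in> \<gamma> t" "w \<in> side D i"
    obtain z where z: "(f, z) \<in> x" "dist w z < \<epsilon>" using rep [OF t *(2)] by blast
    obtain s where s: "s \<in> {0..1}" "w = edge_point i s" using *(3) by (auto simp: side_eq)
    note near' = glued_near [OF x(1) \<epsilon> *(1) s(1) z(1) z(2) [unfolded s(2)], folded s(2)]
    show "U t (fst (partner D (f, i)), gluing_map D (f, i) w) = gluing_rot D (f, i) * U t (f, w)"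
      using U [OF near'(2,3)] U [OF z] frame_glue [OF u *(1) z(1) near'(1)] by simp
  qed
  moreover have "locally_constant a b \<gamma> U"
  proof (rule locally_constantI)
    fix t f w assume "t \<in> {a..b}" "(f, w) \<in> \<gamma> t"
    then obtain z where z: "(f, z) \<in> x" "dist w z < \<epsilon>" using rep by blast
    show "\<exists>e>0. \<forall>t'\<in>{a..b}. \<forall>z'. \<bar>t' - t\<bar> < e \<and> dist z' w < e \<and> (f, z') \<in> \<gamma> t' \<longrightarrow>
        U t' (f, z') = U t (f, w)"
    proof (intro exI [of _ "\<epsilon> - dist w z"] conjI ballI allI impI)
      fix t' z' assume "\<bar>t' - t\<bar> < \<epsilon> - dist w z \<and> dist z' w < \<epsilon> - dist w z \<and> (f, z') \<in> \<gamma> t'"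
      then have "dist z' z < \<epsilon>" using dist_triangle [of z' z w] by linarith
      then show "U t' (f, z') = U t (f, w)" using U z by metis
    qed (use z in simp)
  qed
  ultimately have "parallel_on a b \<gamma> U" unfolding parallel_on_def by blast
  then show thesis by (rule that)
qed

lemma frame_scale: "frame x u \<Longrightarrow> norm c = 1 \<Longrightarrow> frame x (\<lambda>r. c * u r)"
  by (simp add: frame_def norm_mult)

text \<open>The fields may disagree at \<open>b\<close>, but frames at one point differ by a unit
  factor; the second field is rescaled by that factor.\<close>

lemma parallel_on_join:
  assumes \<gamma>: "\<gamma> b \<in> topspace (surface D)" and le: "a \<le> b" "b \<le> c"
    and U: "parallel_on a b \<gamma> U" and V: "parallel_on b c \<gamma> V"
  obtains W where "parallel_on a c \<gamma> W"
proof -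
  obtain r0 where r0: "r0 \<in> \<gamma> b" using surface_point_nonempty [OF \<gamma>] by blast
  have fr: "frame (\<gamma> b) (U b)" "frame (\<gamma> b) (V b)"
    using U V le by (auto simp: parallel_on_def)
  define c' where "c' = U b r0 / V b r0"
  have Ub: "U b r = c' * V b r" if "r \<in> \<gamma> b" for r
    using frame_ratio [OF \<gamma> r0 that fr] frame_nonzero [OF fr(2) that] by (simp add: c'_def divide_eq_eq)
  have c': "norm c' = 1"
    using frame_norm [OF fr(1) r0] frame_norm [OF fr(2) r0] by (simp add: c'_def norm_divide)
  define W where "W t = (if t \<le> b then U t else (\<lambda>r. c' * V t r))" for t
  have "frame (\<gamma> t) (W t)" if "t \<in> {a..c}" for t
    using that U V le frame_scale [OF _ c'] by (auto simp: W_def parallel_on_def)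
  moreover have "locally_constant a c \<gamma> W"
  proof (rule locally_constantI)
    fix t f z assume t: "t \<in> {a..c}" and z: "(f, z) \<in> \<gamma> t"
    have Ut: "\<exists>\<epsilon>>0. \<forall>t'\<in>{a..b}. \<forall>z'. \<bar>t' - t\<bar> < \<epsilon> \<and> dist z' z < \<epsilon> \<and> (f, z') \<in> \<gamma> t' \<longrightarrow>
        W t' (f, z') = W t (f, z)" if "t \<le> b"
    proof -
      have "locally_constant a b \<gamma> U" "t \<in> {a..b}" using U t that by (simp_all add: parallel_on_def)
      then obtain \<epsilon> where "\<epsilon> > 0" "\<And>t' z'. t' \<in> {a..b} \<Longrightarrow> \<bar>t' - t\<bar> < \<epsilon> \<Longrightarrow> dist z' z < \<epsilon> \<Longrightarrow>
          (f, z') \<in> \<gamma> t' \<Longrightarrow> U t' (f, z') = U t (f, z)"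
        using z locally_constantD [of a b \<gamma> U t f z] by blast
      then show ?thesis
        using that by (intro exI [of _ \<epsilon>]) (auto simp: W_def)
    qed
    have Vt: "\<exists>\<epsilon>>0. \<forall>t'\<in>{b..c}. \<forall>z'. \<bar>t' - t\<bar> < \<epsilon> \<and> dist z' z < \<epsilon> \<and> (f, z') \<in> \<gamma> t' \<longrightarrow>
        W t' (f, z') = W t (f, z)" if "b \<le> t"
    proof -
      \<comment> \<open>At \<open>t' = b\<close> the definition of \<open>W\<close> selects
        \<open>U\<close>, which there equals the rescaled \<open>V\<close> by the choice of
        \<open>c'\<close>.\<close>
      have W: "W t' r = c' * V t' r" if "b \<le> t'" "r \<in> \<gamma> t'" for t' r
        using that Ub by (cases "t' = b") (auto simp: W_def)
      have "locally_constant b c \<gamma> V" "t \<in> {b..c}"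
        using V t \<open>b \<le> t\<close> by (simp_all add: parallel_on_def)
      then obtain \<epsilon> where "\<epsilon> > 0" "\<And>t' z'. t' \<in> {b..c} \<Longrightarrow> \<bar>t' - t\<bar> < \<epsilon> \<Longrightarrow> dist z' z < \<epsilon> \<Longrightarrow>
          (f, z') \<in> \<gamma> t' \<Longrightarrow> V t' (f, z') = V t (f, z)"
        using z locally_constantD [of b c \<gamma> V t f z] by blast
      then show ?thesis
        using W z \<open>b \<le> t\<close> by (intro exI [of _ \<epsilon>]) auto
    qed
    consider "t < b" | "t = b" | "b < t" by linarith
    then show "\<exists>\<epsilon>>0. \<forall>t'\<in>{a..c}. \<forall>z'. \<bar>t' - t\<bar> < \<epsilon> \<and> dist z' z < \<epsilon> \<and> (f, z') \<in> \<gamma> t' \<longrightarrow>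
        W t' (f, z') = W t (f, z)"
    proof cases
      case 1
      then obtain \<epsilon> where "\<epsilon> > 0" "\<forall>t'\<in>{a..b}. \<forall>z'. \<bar>t' - t\<bar> < \<epsilon> \<and> dist z' z < \<epsilon> \<and> (f, z') \<in> \<gamma> t' \<longrightarrow>
          W t' (f, z') = W t (f, z)"
        using Ut by auto
      then show ?thesis using 1 by (intro exI [of _ "min \<epsilon> (b - t)"]) auto
    next
      case 2
      obtain \<epsilon>1 where 1: "\<epsilon>1 > 0" "\<forall>t'\<in>{a..b}. \<forall>z'. \<bar>t' - t\<bar> < \<epsilon>1 \<and> dist z' z < \<epsilon>1 \<and> (f, z') \<in> \<gamma> t' \<longrightarrow>
          W t' (f, z') = W t (f, z)"
        using Ut 2 by auto
      obtain \<epsilon>2 where 2: "\<epsilon>2 > 0" "\<forall>t'\<in>{b..c}. \<forall>z'. \<bar>t' - t\<bar> < \<epsilon>2 \<and> dist z' z < \<epsilon>2 \<and> (f, z') \<in> \<gamma> t' \<longrightarrow>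
          W t' (f, z') = W t (f, z)"
        using Vt 2 by auto
      show ?thesis
      proof (intro exI [of _ "min \<epsilon>1 \<epsilon>2"] conjI ballI allI impI)
        fix t' z' assume "t' \<in> {a..c}" "\<bar>t' - t\<bar> < min \<epsilon>1 \<epsilon>2 \<and> dist z' z < min \<epsilon>1 \<epsilon>2 \<and> (f, z') \<in> \<gamma> t'"
        then show "W t' (f, z') = W t (f, z)" using 1 2 by (cases "t' \<le> b") auto
      qed (use 1 2 in simp)
    next
      case 3
      then obtain \<epsilon> where "\<epsilon> > 0" "\<forall>t'\<in>{b..c}. \<forall>z'. \<bar>t' - t\<bar> < \<epsilon> \<and> dist z' z < \<epsilon> \<and> (f, z') \<in> \<gamma> t' \<longrightarrow>
          W t' (f, z') = W t (f, z)"
        using Vt by auto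
      then show ?thesis using 3 by (intro exI [of _ "min \<epsilon> (t - b)"]) auto
    qed
  qed
  ultimately have "parallel_on a c \<gamma> W" unfolding parallel_on_def by blast
  then show thesis by (rule that)
qed

text \<open>Fields on short intervals come from stars, and bisection joins them. Avoiding the
  vertices makes a frame available at the centre of each star.\<close>

lemma parallel_along_exists:
  assumes \<gamma>: "pathin (punctured_surface D) \<gamma>"
  obtains U where "parallel_along D \<gamma> U"
proof -
  have top: "\<gamma> t \<in> topspace (surface D)" "\<gamma> t \<notin> vertices D" if "t \<in> {0..1}" for t
    using pathin_into_topspace [OF \<gamma> that] by (auto simp: topspace_punctured_surface)
  have "0 \<le> (0::real) \<and> (0::real) \<le> 1 \<and> (1::real) \<le> 1 \<longrightarrow> (\<exists>U. parallel_on 0 1 \<gamma> U)"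
  proof (rule Bolzano [where P = "\<lambda>a b. 0 \<le> a \<and> a \<le> b \<and> b \<le> 1 \<longrightarrow> (\<exists>U. parallel_on a b \<gamma> U)"])
    fix a b c :: real
    assume "0 \<le> a \<and> a \<le> b \<and> b \<le> 1 \<longrightarrow> (\<exists>U. parallel_on a b \<gamma> U)"
      "0 \<le> b \<and> b \<le> c \<and> c \<le> 1 \<longrightarrow> (\<exists>U. parallel_on b c \<gamma> U)" "a \<le> b" "b \<le> c"
    then show "0 \<le> a \<and> a \<le> c \<and> c \<le> 1 \<longrightarrow> (\<exists>U. parallel_on a c \<gamma> U)"
      using parallel_on_join [of \<gamma> b a c] top(1) [of b] by (metis atLeastAtMost_iff order_trans)
  next
    fix t :: real assume "0 \<le> t" "t \<le> 1"
    then have t: "t \<in> {0..1}" by simp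
    obtain \<epsilon> where \<epsilon>: "star_radius (\<gamma> t) \<epsilon>"
      using star_radius_exists [OF top(1) [OF t] zero_less_one] .
    obtain d where d: "d > 0" "\<And>s. s \<in> {0..1} \<Longrightarrow> \<bar>s - t\<bar> < d \<Longrightarrow> \<gamma> s \<in> star (\<gamma> t) \<epsilon>"
      using pathin_stays_in_star [OF pathin_punctured_imp_surface [OF \<gamma>] t \<epsilon>] by blast
    show "\<exists>d>0. \<forall>a b. a \<le> t \<and> t \<le> b \<and> b - a < d \<longrightarrow>
        0 \<le> a \<and> a \<le> b \<and> b \<le> 1 \<longrightarrow> (\<exists>U. parallel_on a b \<gamma> U)"
    proof (intro exI [of _ d] conjI allI impI)
      fix a b assume ab: "a \<le> t \<and> t \<le> b \<and> b - a < d" "0 \<le> a \<and> a \<le> b \<and> b \<le> 1"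
      have "\<gamma> s \<in> star (\<gamma> t) \<epsilon>" if "s \<in> {a..b}" for s
        using that ab by (intro d(2)) auto
      then show "\<exists>U. parallel_on a b \<gamma> U"
        using local_parallel_field [OF top [OF t] \<epsilon>] by metis
    qed (use d in simp)
  qed auto
  then show thesis using that by (auto simp: parallel_along_iff)
qed

section \<open>Holonomy coefficients of paths\<close>

lemma parallel_along_frame: "parallel_along D \<gamma> U \<Longrightarrow> t \<in> {0..1} \<Longrightarrow> frame (\<gamma> t) (U t)"
  by (simp add: parallel_along_iff parallel_on_def)

lemma locally_constant_map2:
  assumes "locally_constant a b \<gamma> U" "locally_constant a b \<gamma> V"
  shows "locally_constant a b \<gamma> (\<lambda>t r. h (U t r) (V t r))"
proof (rule locally_constantI)
  fix t f z assume t: "t \<in> {a..b}" and z: "(f, z) \<in> \<gamma> t"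
  obtain e1 where 1: "e1 > 0" "\<And>t' z'. t' \<in> {a..b} \<Longrightarrow> \<bar>t' - t\<bar> < e1 \<Longrightarrow> dist z' z < e1 \<Longrightarrow>
      (f, z') \<in> \<gamma> t' \<Longrightarrow> U t' (f, z') = U t (f, z)"
    using locally_constantD [OF assms(1) t z] by blast
  obtain e2 where 2: "e2 > 0" "\<And>t' z'. t' \<in> {a..b} \<Longrightarrow> \<bar>t' - t\<bar> < e2 \<Longrightarrow> dist z' z < e2 \<Longrightarrow>
      (f, z') \<in> \<gamma> t' \<Longrightarrow> V t' (f, z') = V t (f, z)"
    using locally_constantD [OF assms(2) t z] by blast
  show "\<exists>\<epsilon>>0. \<forall>t'\<in>{a..b}. \<forall>z'. \<bar>t' - t\<bar> < \<epsilon> \<and> dist z' z < \<epsilon> \<and> (f, z') \<in> \<gamma> t' \<longrightarrow>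
      h (U t' (f, z')) (V t' (f, z')) = h (U t (f, z)) (V t (f, z))"
    using 1 2 by (intro exI [of _ "min e1 e2"]) auto
qed

text \<open>No face is distinguished at a point, so the coefficient refers to chosen coordinates at
  both ends. The field picked by \<open>SOME\<close> is immaterial by
  \<open>parallel_along_hol\<close>.\<close>

definition hol :: "(real \<Rightarrow> ('f \<times> complex) set) \<Rightarrow> 'f \<times> complex \<Rightarrow> 'f \<times> complex \<Rightarrow> complex" where
  "hol \<gamma> r s = (let U = (SOME U. parallel_along D \<gamma> U) in U 1 s / U 0 r)"

text \<open>The quotient of two parallel fields is locally constant and unchanged by gluing, hence
  constant along the path.\<close>

lemma parallel_along_hol:
  assumes \<gamma>: "pathin (punctured_surface D) \<gamma>" and rs: "r \<in> \<gamma> 0" "s \<in> \<gamma> 1"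
    and V: "parallel_along D \<gamma> V"
  shows "V 1 s = hol \<gamma> r s * V 0 r"
proof -
  define U where "U = (SOME U. parallel_along D \<gamma> U)"
  have U: "parallel_along D \<gamma> U"
    unfolding U_def using parallel_along_exists [OF \<gamma>] by (metis someI)
  have "V 1 s / U 1 s = V 0 r / U 0 r"
  proof (rule locally_constant_invariant_constant [OF pathin_punctured_imp_surface [OF \<gamma>] _ _ rs])
    show "locally_constant 0 1 \<gamma> (\<lambda>t r. V t r / U t r)"
      using U V by (auto simp: parallel_along_iff parallel_on_def intro: locally_constant_map2)
    show "V t (fst (partner D (f, i)), gluing_map D (f, i) z) / U t (fst (partner D (f, i)), gluing_map D (f, i) z)
        = V t (f, z) / U t (f, z)"
      if "t \<in> {0..1}" "(f, i) \<in> face_sides D" "(f, z) \<in> \<gamma> t" "z \<in> side D i" for t f i z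
      using frame_glue [OF parallel_along_frame [OF U that(1)] that(2-4)]
        frame_glue [OF parallel_along_frame [OF V that(1)] that(2-4)] gluing_rot_nonzero by simp
  qed
  moreover have "U 1 s \<noteq> 0" "U 0 r \<noteq> 0"
    using frame_nonzero [OF parallel_along_frame [OF U]] rs by auto
  ultimately show ?thesis
    by (simp add: hol_def Let_def field_simps flip: U_def)
qed

lemma hol_eqI:
  assumes \<gamma>: "pathin (punctured_surface D) \<gamma>" and rs: "r \<in> \<gamma> 0" "s \<in> \<gamma> 1"
    and c: "\<And>V. parallel_along D \<gamma> V \<Longrightarrow> V 1 s = c * V 0 r"
  shows "hol \<gamma> r s = c"
proof -
  obtain V where V: "parallel_along D \<gamma> V" using parallel_along_exists [OF \<gamma>] .
  have "V 0 r \<noteq> 0" using frame_nonzero [OF parallel_along_frame [OF V]] rs by auto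
  then show ?thesis
    using parallel_along_hol [OF \<gamma> rs V] c [OF V] by simp
qed

lemma norm_hol:
  assumes \<gamma>: "pathin (punctured_surface D) \<gamma>" and rs: "r \<in> \<gamma> 0" "s \<in> \<gamma> 1"
  shows "norm (hol \<gamma> r s) = 1"
proof -
  obtain V where V: "parallel_along D \<gamma> V" using parallel_along_exists [OF \<gamma>] .
  have "norm (V 0 r) = 1" "norm (V 1 s) = 1"
    using frame_norm [OF parallel_along_frame [OF V]] rs by auto
  then show ?thesis
    using parallel_along_hol [OF \<gamma> rs V] by (metis mult.right_neutral norm_mult)
qed

text \<open>Since \<open>\<phi>\<close> does not increase distances, the old tolerance still works.
  Used for the two halves of a joined path, for reversal and for the identity.\<close>

lemma parallel_along_reparametrize:
  assumes U: "parallel_along D \<gamma> U"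
    and \<phi>: "\<And>t. t \<in> {0..1} \<Longrightarrow> \<phi> t \<in> {0..1}" "\<And>t. t \<in> {0..1} \<Longrightarrow> \<gamma>' t = \<gamma> (\<phi> t)"
    and contract: "\<And>t t'. \<bar>\<phi> t' - \<phi> t\<bar> \<le> \<bar>t' - t\<bar>"
  shows "parallel_along D \<gamma>' (\<lambda>t. U (\<phi> t))"
  unfolding parallel_along_iff parallel_on_def
proof
  show "\<forall>t\<in>{0..1}. frame (\<gamma>' t) (U (\<phi> t))"
    using parallel_along_frame [OF U] \<phi> by simp
  show "locally_constant 0 1 \<gamma>' (\<lambda>t. U (\<phi> t))"
  proof (rule locally_constantI)
    fix t f z assume t: "t \<in> {0..1::real}" and z: "(f, z) \<in> \<gamma>' t"
    have lc: "locally_constant 0 1 \<gamma> U" using U by (simp add: parallel_along_iff parallel_on_def)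
    have z': "(f, z) \<in> \<gamma> (\<phi> t)" using z \<phi>(2) [OF t] by simp
    obtain e where e: "e > 0" "\<And>t' z'. t' \<in> {0..1} \<Longrightarrow> \<bar>t' - \<phi> t\<bar> < e \<Longrightarrow> dist z' z < e \<Longrightarrow>
        (f, z') \<in> \<gamma> t' \<Longrightarrow> U t' (f, z') = U (\<phi> t) (f, z)"
      using locally_constantD [OF lc \<phi>(1) [OF t] z'] by blast
    show "\<exists>\<epsilon>>0. \<forall>t'\<in>{0..1}. \<forall>z'. \<bar>t' - t\<bar> < \<epsilon> \<and> dist z' z < \<epsilon> \<and> (f, z') \<in> \<gamma>' t' \<longrightarrow>
        U (\<phi> t') (f, z') = U (\<phi> t) (f, z)"
    proof (intro exI [of _ e] conjI ballI allI impI)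
      fix t' z' assume t': "t' \<in> {0..1::real}" "\<bar>t' - t\<bar> < e \<and> dist z' z < e \<and> (f, z') \<in> \<gamma>' t'"
      then show "U (\<phi> t') (f, z') = U (\<phi> t) (f, z)"
        using e(2) [of "\<phi> t'" z'] \<phi> [OF t'(1)] contract [of t' t] by simp
    qed (use e in simp)
  qed
qed

text \<open>Paths are functions on all reals, whereas lifts are prescribed only on
  \<open>{0..1}\<close>.\<close>

lemma hol_cong:
  assumes \<gamma>: "pathin (punctured_surface D) \<gamma>" "pathin (punctured_surface D) \<gamma>'"
    and eq: "\<And>t. t \<in> {0..1} \<Longrightarrow> \<gamma>' t = \<gamma> t" and rs: "r \<in> \<gamma> 0" "s \<in> \<gamma> 1"
  shows "hol \<gamma>' r s = hol \<gamma> r s"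
proof (rule hol_eqI [OF \<gamma>(2)])
  show "r \<in> \<gamma>' 0" "s \<in> \<gamma>' 1" using rs eq by auto
  fix V assume "parallel_along D \<gamma>' V"
  then have "parallel_along D \<gamma> (\<lambda>t. V t)"
    by (rule parallel_along_reparametrize [where \<phi> = "\<lambda>t. t"]) (use eq in auto)
  then show "V 1 s = hol \<gamma> r s * V 0 r"
    using parallel_along_hol [OF \<gamma>(1) rs] by simp
qed

lemma hol_join_path:
  assumes \<gamma>: "pathin (punctured_surface D) \<gamma>1" "pathin (punctured_surface D) \<gamma>2" and eq: "\<gamma>1 1 = \<gamma>2 0"
    and r: "r1 \<in> \<gamma>1 0" "r2 \<in> \<gamma>2 0" "r3 \<in> \<gamma>2 1"
  shows "hol (join_path \<gamma>1 \<gamma>2) r1 r3 = hol \<gamma>1 r1 r2 * hol \<gamma>2 r2 r3"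
proof (rule hol_eqI [OF pathin_join_path [OF \<gamma> eq]])
  fix V assume V: "parallel_along D (join_path \<gamma>1 \<gamma>2) V"
  have 1: "parallel_along D \<gamma>1 (\<lambda>t. V (t / 2))"
    by (rule parallel_along_reparametrize [OF V]) (auto simp: join_path_first_half)
  have "r2 \<in> \<gamma>1 1" using r(2) eq by simp
  from parallel_along_hol [OF \<gamma>(1) r(1) this 1] have "V (1 / 2) r2 = hol \<gamma>1 r1 r2 * V 0 r1"
    by simp
  moreover have 2: "parallel_along D \<gamma>2 (\<lambda>t. V ((t + 1) / 2))"
    by (rule parallel_along_reparametrize [OF V])
      (auto simp: join_path_second_half eq simp flip: diff_divide_distrib)
  from parallel_along_hol [OF \<gamma>(2) r(2,3) 2] have "V 1 r3 = hol \<gamma>2 r2 r3 * V (1 / 2) r2"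
    by simp
  ultimately show "V 1 r3 = hol \<gamma>1 r1 r2 * hol \<gamma>2 r2 r3 * V 0 r1"
    by simp
qed (use r in auto)

lemma hol_rev_path:
  assumes \<gamma>: "pathin (punctured_surface D) \<gamma>" and rs: "r \<in> \<gamma> 0" "s \<in> \<gamma> 1"
  shows "hol (rev_path \<gamma>) s r = inverse (hol \<gamma> r s)"
proof (rule hol_eqI [OF pathin_rev_path [OF \<gamma>]])
  fix V assume V: "parallel_along D (rev_path \<gamma>) V"
  have "parallel_along D \<gamma> (\<lambda>t. V (1 - t))"
    by (rule parallel_along_reparametrize [OF V]) (auto simp: rev_path_def)
  then have "V 0 s = hol \<gamma> r s * V 1 r"
    using parallel_along_hol [OF \<gamma> rs, of "\<lambda>t. V (1 - t)"] by simp
  moreover have "hol \<gamma> r s \<noteq> 0" using norm_hol [OF \<gamma> rs] by auto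
  ultimately show "V 1 r = inverse (hol \<gamma> r s) * V 0 s" by simp
qed (use rs in auto)

lemma trivial_holonomy_iff:
  assumes \<gamma>: "pathin (punctured_surface D) \<gamma>" and eq: "\<gamma> 0 = \<gamma> 1" and r: "r \<in> \<gamma> 0"
  shows "trivial_holonomy D \<gamma> \<longleftrightarrow> hol \<gamma> r r = 1"
proof
  have r1: "r \<in> \<gamma> 1" using r eq by simp
  assume "trivial_holonomy D \<gamma>"
  then obtain n :: int and U where U: "parallel_along D \<gamma> U" "U 1 r = cis (2 * pi * of_int n) * U 0 r"
    using r by (auto simp: trivial_holonomy_def has_holonomy_def)
  have "U 0 r \<noteq> 0" using frame_nonzero [OF parallel_along_frame [OF U(1)]] r by auto
  then show "hol \<gamma> r r = 1"
    using U(2) parallel_along_hol [OF \<gamma> r r1 U(1)] by (simp add: cis_multiple_2pi)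
next
  have r1: "r \<in> \<gamma> 1" using r eq by simp
  have top: "\<gamma> 0 \<in> topspace (surface D)"
    using pathin_into_topspace [OF pathin_punctured_imp_surface [OF \<gamma>]] by simp
  assume hol: "hol \<gamma> r r = 1"
  obtain U where U: "parallel_along D \<gamma> U" using parallel_along_exists [OF \<gamma>] .
  have fr: "frame (\<gamma> 0) (U 1)" "frame (\<gamma> 0) (U 0)"
    using parallel_along_frame [OF U, of 0] parallel_along_frame [OF U, of 1] eq by simp_all
  \<comment> \<open>\<open>has_holonomy\<close> concerns every representative;
    \<open>frame_ratio\<close> transfers the equality from \<open>r\<close> to the others.\<close>
  have "U 1 r' = U 0 r'" if r': "r' \<in> \<gamma> 0" for r'
    using frame_ratio [OF top r r' fr] parallel_along_hol [OF \<gamma> r r1 U] hol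
      frame_nonzero [OF fr(2) r] frame_nonzero [OF fr(2) r'] by simp
  then have "has_holonomy D \<gamma> (2 * pi * of_int 0)"
    using U by (auto simp: has_holonomy_def)
  then show "trivial_holonomy D \<gamma>" unfolding trivial_holonomy_def by blast
qed

text \<open>Every transition rotation has \<open>N\<close>-th power 1: evenness of \<open>N\<close>
  removes the sign, divisibility by \<open>p\<close> the power of \<open>zeta\<close>. Hence the
  \<open>N\<close>-th power of a parallel field is constant.\<close>

lemma hol_root_of_unity:
  assumes \<gamma>: "pathin (punctured_surface D) \<gamma>" and eq: "\<gamma> 0 = \<gamma> 1" and r: "r \<in> \<gamma> 0"
    and N: "even N" "p dvd N"
  shows "hol \<gamma> r r ^ N = 1"
proof -
  obtain U where U: "parallel_along D \<gamma> U" using parallel_along_exists [OF \<gamma>] .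
  have r1: "r \<in> \<gamma> 1" using r eq by simp
  have "zeta ^ N = 1" using N(2) by (auto simp: power_mult elim!: dvdE)
  then have rot: "gluing_rot D s ^ N = 1" for s
    using N(1) by (simp add: gluing_rot_eq power_divide flip: power_mult) (simp add: mult.commute power_mult)
  have "U 1 r ^ N = U 0 r ^ N"
  proof (rule locally_constant_invariant_constant [OF pathin_punctured_imp_surface [OF \<gamma>] _ _ r r1])
    have "locally_constant 0 1 \<gamma> U" using U by (simp add: parallel_along_iff parallel_on_def)
    then show "locally_constant 0 1 \<gamma> (\<lambda>t r. U t r ^ N)"
      using locally_constant_map2 [of 0 1 \<gamma> U U "\<lambda>a b. a ^ N"] by simp
    show "U t (fst (partner D (f, i)), gluing_map D (f, i) z) ^ N = U t (f, z) ^ N"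
      if "t \<in> {0..1}" "(f, i) \<in> face_sides D" "(f, z) \<in> \<gamma> t" "z \<in> side D i" for t f i z
      using frame_glue [OF parallel_along_frame [OF U that(1)] that(2-4)] rot
      by (simp add: power_mult_distrib)
  qed
  moreover have "U 0 r \<noteq> 0" using frame_nonzero [OF parallel_along_frame [OF U]] r by auto
  ultimately show ?thesis
    using parallel_along_hol [OF \<gamma> r r1 U] by (simp add: power_mult_distrib)
qed

text \<open>In the fixed coordinates of \<open>f\<close> a parallel field is locally constant along
  \<open>(f, g t)\<close>, also at times when the path lies on a side; bisection makes it
  constant.\<close>

lemma hol_in_face:
  assumes f: "f \<in> faces D" and g: "path g" "path_image g \<subseteq> polygon D - corner D ` {..<p}"
  shows "pathin (punctured_surface D) (\<lambda>t. proj D (f, g t))"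
    and "hol (\<lambda>t. proj D (f, g t)) (f, g 0) (f, g 1) = 1"
proof -
  have "pathin (surface D) (\<lambda>t. proj D (f, g t))"
    using g by (intro pathin_in_face f) auto
  then show path: "pathin (punctured_surface D) (\<lambda>t. proj D (f, g t))"
    using g(2) pathin_into_topspace proj_in_vertices_iff [OF f]
    by (fastforce simp: punctured_surface_def pathin_subtopology path_image_def)
  show "hol (\<lambda>t. proj D (f, g t)) (f, g 0) (f, g 1) = 1"
  proof (rule hol_eqI [OF path])
    fix V assume V: "parallel_along D (\<lambda>t. proj D (f, g t)) V"
    have "0 \<le> (0::real) \<and> (1::real) \<le> 1 \<longrightarrow> V 0 (f, g 0) = V 1 (f, g 1)"
    proof (rule Bolzano [where P = "\<lambda>a b. 0 \<le> a \<and> b \<le> 1 \<longrightarrow> V a (f, g a) = V b (f, g b)"])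
      fix t :: real assume "0 \<le> t" "t \<le> 1"
      then have t: "t \<in> {0..1}" by simp
      have "locally_constant 0 1 (\<lambda>t. proj D (f, g t)) V"
        using V by (simp add: parallel_along_iff parallel_on_def)
      then obtain e where e: "e > 0" "\<And>t' z'. t' \<in> {0..1} \<Longrightarrow> \<bar>t' - t\<bar> < e \<Longrightarrow> dist z' (g t) < e \<Longrightarrow>
          (f, z') \<in> proj D (f, g t') \<Longrightarrow> V t' (f, z') = V t (f, g t)"
        using t proj_self [of "(f, g t)"] locally_constantD [of 0 1 "\<lambda>t. proj D (f, g t)" V t f "g t"] by blast
      obtain d where d: "d > 0" "\<And>s. s \<in> {0..1} \<Longrightarrow> \<bar>s - t\<bar> < d \<Longrightarrow> dist (g s) (g t) < e"
        using g(1) t e(1) unfolding path_def continuous_on_iff by (metis dist_real_def)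
      have near: "V s (f, g s) = V t (f, g t)" if "s \<in> {0..1}" "\<bar>s - t\<bar> < min d e" for s
        using that d(2) [of s] by (intro e(2)) auto
      show "\<exists>d>0. \<forall>a b. a \<le> t \<and> t \<le> b \<and> b - a < d \<longrightarrow>
          0 \<le> a \<and> b \<le> 1 \<longrightarrow> V a (f, g a) = V b (f, g b)"
      proof (intro exI [of _ "min d e"] conjI allI impI)
        fix a b assume "a \<le> t \<and> t \<le> b \<and> b - a < min d e" "0 \<le> a \<and> b \<le> 1"
        then show "V a (f, g a) = V b (f, g b)" using near [of a] near [of b] by auto
      qed (use d e in auto)
    qed auto
    then show "V 1 (f, g 1) = 1 * V 0 (f, g 0)" by simp
  qed auto
qed

text \<open>A path that crosses an edge is cut there and its remainder is read in the coordinates of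
  the new face; this supplies the factor for the change of coordinates.\<close>

lemma hol_glue_start:
  assumes \<gamma>: "pathin (punctured_surface D) \<gamma>" and s: "s \<in> \<gamma> 1"
    and z: "(f, i) \<in> face_sides D" "(f, z) \<in> \<gamma> 0" "z \<in> side D i"
  shows "hol \<gamma> (f, z) s = hol \<gamma> (fst (partner D (f, i)), gluing_map D (f, i) z) s * gluing_rot D (f, i)"
proof (rule hol_eqI [OF \<gamma> z(2) s])
  fix V assume V: "parallel_along D \<gamma> V"
  have "\<gamma> 0 \<in> topspace (surface D)"
    using pathin_into_topspace [OF pathin_punctured_imp_surface [OF \<gamma>]] by simp
  then have "(fst (partner D (f, i)), gluing_map D (f, i) z) \<in> \<gamma> 0"
    using glue_in_point z by blast
  from parallel_along_hol [OF \<gamma> this s V]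
  show "V 1 s = hol \<gamma> (fst (partner D (f, i)), gluing_map D (f, i) z) s * gluing_rot D (f, i) * V 0 (f, z)"
    using frame_glue [OF parallel_along_frame [OF V, of 0] z] by simp
qed

section \<open>Holonomy around a vertex\<close>

text \<open>Crossing the side that starts at a corner leads to the next corner at the same vertex.\<close>

definition next_corner :: "'f \<times> nat \<Rightarrow> 'f \<times> nat" where
  "next_corner s = (if s \<in> face_sides D then (fst (partner D s), Suc (snd (partner D s)) mod p) else s)"

lemma Suc_mod_inj:
  assumes "Suc i mod p = Suc j mod p" "i < p" "j < p" shows "i = j"
  using assms by (simp add: mod_Suc split: if_splits)

lemma next_corner_closed: "s \<in> face_sides D \<Longrightarrow> next_corner s \<in> face_sides D"
  using partner_closed [of s] p_ge_3 by (cases "partner D s") (simp add: next_corner_def mem_face_sides)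

text \<open>An involution followed by a cyclic shift of the index; outside the sides the map is the
  identity, as \<open>permutes\<close> demands.\<close>

lemma next_corner_permutes: "next_corner permutes face_sides D"
proof (rule bij_imp_permutes)
  have inj: "inj_on next_corner (face_sides D)"
  proof (rule inj_onI)
    fix s t assume st: "s \<in> face_sides D" "t \<in> face_sides D" "next_corner s = next_corner t"
    obtain g j h l where p: "partner D s = (g, j)" "partner D t = (h, l)" by fastforce
    then have "j < p" "l < p"
      using partner_closed [OF st(1)] partner_closed [OF st(2)] by (simp_all add: mem_face_sides)
    then have "partner D s = partner D t"
      using st p Suc_mod_inj [of j l] by (simp add: next_corner_def)
    then show "s = t" using partner_partner st(1,2) by metis
  qed
  moreover have "next_corner ` face_sides D = face_sides D"
    using next_corner_closed inj by (intro endo_inj_surj finite_face_sides) auto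
  ultimately show "bij_betw next_corner (face_sides D) (face_sides D)"
    by (simp add: bij_betw_def)
qed (simp add: next_corner_def)

lemma orbit_next_corner_subset: "s \<in> face_sides D \<Longrightarrow> orbit next_corner s \<subseteq> face_sides D"
  by (rule permutes_orbit_subset [OF next_corner_permutes])

lemma next_corner_self_in_orbit: "s \<in> orbit next_corner s"
  by (rule permutation_self_in_orbit)
    (use next_corner_permutes finite_face_sides in \<open>auto simp: permutation_permutes\<close>)

text \<open>Orbits of a permutation of a finite set are cycles. Backward steps are needed because a
  chain of gluings may turn around the vertex in either direction.\<close>

lemma next_corner_orbit_backward:
  assumes "next_corner s \<in> orbit next_corner t" shows "s \<in> orbit next_corner t"
proof -
  have cyc: "cyclic_on next_corner (orbit next_corner x)" for x
    by (rule cyclic_on_orbit [OF next_corner_permutes finite_face_sides])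
  have "next_corner s \<in> orbit next_corner s" by (rule orbit.base)
  then have "orbit next_corner t = orbit next_corner s"
    using orbit_cyclic_eq3 [OF cyc assms] orbit_cyclic_eq3 [OF cyc] by metis
  then show ?thesis using next_corner_self_in_orbit by simp
qed

lemma glued_next_corner:
  assumes "(f, i) \<in> face_sides D" "next_corner (f, i) = (g, j)"
  shows "((f, corner D i), (g, corner D j)) \<in> glued D"
proof -
  have "g = fst (partner D (f, i))" "corner D j = edge_point (snd (partner D (f, i))) (1 - 0)"
    using assms by (auto simp: next_corner_def corner_mod edge_point_1)
  then show ?thesis
    unfolding glued_iff using assms(1)
    by (intro exI [of _ f] exI [of _ i] exI [of _ g] exI [of _ "snd (partner D (f, i))"] exI [of _ 0])
      (simp add: edge_point_0 prod_eq_iff)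
qed

lemma vertex_representatives:
  assumes s0: "(f0, i0) \<in> face_sides D" and r: "r \<in> proj D (f0, corner D i0)"
  shows "\<exists>f i. (f, i) \<in> orbit next_corner (f0, i0) \<and> r = (f, corner D i)"
  using r
proof (induction rule: proj_induct)
  case self
  show ?case
    by (intro exI [of _ f0] exI [of _ i0] conjI next_corner_self_in_orbit) simp
next
  case (glued y z)
  from glued.IH obtain f i where fi: "(f, i) \<in> orbit next_corner (f0, i0)" "y = (f, corner D i)"
    by (elim exE conjE)
  have side: "(f, i) \<in> face_sides D" using subsetD [OF orbit_next_corner_subset [OF s0] fi(1)] .
  from glued.hyps(2) obtain f' i' g j s where *: "(f', i') \<in> face_sides D" "partner D (f', i') = (g, j)"
      "y = (f', edge_point i' s)" "z = (g, edge_point j (1 - s))"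
    unfolding glued_iff by (elim exE conjE)
  have "f' = f" and i': "edge_point i' s = corner D i" using *(3) fi(2) by simp_all
  note * = *(1,2) [unfolded \<open>f' = f\<close>] i' [symmetric] *(4)
  have "s = 0 \<or> s = 1"
    using norm_edge_point_eq_R_iff [of i' s] norm_corner [of i] i' by simp
  then show ?case
  proof
    \<comment> \<open>The side that starts at the corner is crossed: one step of
      \<open>next_corner\<close>.\<close>
    assume s: "s = 0"
    then have "i' = i"
      using * side corner_inj [of i i'] by (simp add: edge_point_0 mem_face_sides)
    then have "next_corner (f, i) = (g, Suc j mod p)" "z = (g, corner D (Suc j mod p))"
      using * s by (simp_all add: next_corner_def edge_point_1 corner_mod)
    then show ?thesis using orbit.step [OF fi(1)]
      by (intro exI [of _ g] exI [of _ "Suc j mod p"] conjI) simp_all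
  next
    \<comment> \<open>The side that ends at the corner is crossed, so \<open>z\<close> is the
      preceding corner in the cycle.\<close>
    assume s: "s = 1"
    have "i = Suc i' mod p"
      using * s side p_ge_3 corner_inj [of i "Suc i' mod p"]
      by (simp add: edge_point_1 mem_face_sides corner_mod)
    moreover have gj: "(g, j) \<in> face_sides D" "partner D (g, j) = (f, i')"
      using partner_closed [OF *(1)] partner_partner [OF *(1)] unfolding *(2) .
    ultimately have "next_corner (g, j) = (f, i)" by (simp only: next_corner_def if_True fst_conv snd_conv)
    then have "next_corner (g, j) \<in> orbit next_corner (f0, i0)"
      using fi(1) by (simp only:)
    then have "(g, j) \<in> orbit next_corner (f0, i0)"
      by (rule next_corner_orbit_backward)
    moreover have "z = (g, corner D j)" using *(4) s by (simp add: edge_point_0)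
    ultimately show ?thesis by (intro exI [of _ g] exI [of _ j] conjI)
  qed
qed

lemma corners_at_vertex:
  assumes s0: "(f0, i0) \<in> face_sides D"
  shows "{(f, i) \<in> face_sides D. proj D (f, corner D i) = proj D (f0, corner D i0)} =
    orbit next_corner (f0, i0)"
proof (intro equalityI subsetI)
  fix s assume "s \<in> {(f, i) \<in> face_sides D. proj D (f, corner D i) = proj D (f0, corner D i0)}"
  then obtain f i where s: "s = (f, i)" "(f, i) \<in> face_sides D"
      and eq: "proj D (f, corner D i) = proj D (f0, corner D i0)"
    by blast
  have "(f, corner D i) \<in> proj D (f0, corner D i0)"
    unfolding eq [symmetric] by (rule proj_self)
  then obtain i' where i': "(f, i') \<in> orbit next_corner (f0, i0)" "corner D i = corner D i'"
    using vertex_representatives [OF s0] by blast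
  then have "(f, i') \<in> face_sides D" using orbit_next_corner_subset [OF s0] by blast
  then have "i = i'" using i' s corner_inj by (simp add: mem_face_sides)
  then show "s \<in> orbit next_corner (f0, i0)" using i' s by simp
next
  fix s assume s: "s \<in> orbit next_corner (f0, i0)"
  then have "proj D (fst s, corner D (snd s)) = proj D (f0, corner D i0)"
  proof induction
    case base
    then show ?case
      using glued_next_corner [OF s0 prod.collapse [symmetric]] proj_glued by blast
  next
    case (step s)
    then have "s \<in> face_sides D" using orbit_next_corner_subset [OF s0] by blast
    then have "proj D (fst (next_corner s), corner D (snd (next_corner s))) = proj D (fst s, corner D (snd s))"
      using glued_next_corner [of "fst s" "snd s"] proj_glued by simp
    then show ?case using step by simp
  qed
  then show "s \<in> {(f, i) \<in> face_sides D. proj D (f, corner D i) = proj D (f0, corner D i0)}"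
    using s orbit_next_corner_subset [OF s0] by auto
qed

text \<open>By \<open>corners_at_vertex\<close> the degree counts one orbit, and the length of a
  cycle is its return time.\<close>

lemma next_corner_vertex_degree:
  assumes s0: "(f0, i0) \<in> face_sides D"
  shows "(next_corner ^^ vertex_degree D (proj D (f0, corner D i0))) (f0, i0) = (f0, i0)"
proof -
  let ?n = "funpow_dist1 next_corner (f0, i0) (f0, i0)"
  note self = next_corner_self_in_orbit [of "(f0, i0)"]
  have "vertex_degree D (proj D (f0, corner D i0)) = card (orbit next_corner (f0, i0))"
    by (simp add: vertex_degree_def corners_at_vertex [OF s0])
  also have "\<dots> = ?n"
    using inj_on_funpow_dist1 [OF self] orbit_conv_funpow_dist1 [OF self] by (simp add: card_image)
  finally show ?thesis using funpow_dist1_prop [OF self] by simp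
qed

text \<open>The parameter 1/2 is fixed under exchanging \<open>s\<close> and \<open>1 - s\<close>,
  so gluing carries midpoints to midpoints.\<close>

abbreviation midpoint_rep :: "'f \<times> nat \<Rightarrow> 'f \<times> complex" where
  "midpoint_rep s \<equiv> (fst s, edge_point (snd s) (1 / 2))"

lemma norm_midpoint: "norm (edge_point i (1 / 2)) < R"
proof -
  have "(norm (edge_point i (1 / 2)))\<^sup>2 < R\<^sup>2"
    unfolding norm_edge_point using R_pos Re_zeta_less by simp
  then show ?thesis using R_pos by (simp add: power2_less_imp_less)
qed

text \<open>The open disc of radius \<open>R\<close> is convex, contains all side midpoints and
  contains no corner.\<close>

lemma segment_between_midpoints:
  "path_image (linepath (edge_point i (1 / 2)) (edge_point j (1 / 2))) \<subseteq> polygon D - corner D ` {..<p}"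
proof -
  have "closed_segment (edge_point i (1 / 2)) (edge_point j (1 / 2)) \<subseteq> polygon D"
    by (intro closed_segment_subset edge_point_in_polygon polygon_convex) auto
  moreover have "closed_segment (edge_point i (1 / 2)) (edge_point j (1 / 2)) \<subseteq> ball 0 R"
    by (intro closed_segment_subset convex_ball) (simp_all add: norm_midpoint)
  moreover have "corner D ` {..<p} \<inter> ball 0 R = {}"
    by (auto simp: norm_corner)
  ultimately show ?thesis by auto
qed

text \<open>Each step crosses a side and then runs inside the new face to the midpoint of the next
  side at the vertex. The crossing factor \<open>- zeta ^ j / zeta ^ i\<close> equals
  \<open>- inverse zeta\<close> times \<open>zeta ^ Suc j / zeta ^ i\<close>, and the latter
  quotients telescope.\<close>

lemma rotate_about_vertex:
  assumes s0: "s0 \<in> face_sides D"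
  shows "\<exists>\<gamma>. pathin (punctured_surface D) \<gamma> \<and> \<gamma> 0 = proj D (midpoint_rep s0) \<and>
    \<gamma> 1 = proj D (midpoint_rep ((next_corner ^^ n) s0)) \<and>
    hol \<gamma> (midpoint_rep s0) (midpoint_rep ((next_corner ^^ n) s0)) =
      (- inverse zeta) ^ n * zeta ^ snd ((next_corner ^^ n) s0) / zeta ^ snd s0"
proof (induction n)
  case 0
  have "fst s0 \<in> faces D" using s0 by (cases s0) (simp add: mem_face_sides)
  from hol_in_face [OF this path_linepath segment_between_midpoints [of "snd s0" "snd s0"]]
  show ?case
    by (intro exI [of _ "\<lambda>t. proj D (fst s0, linepath (edge_point (snd s0) (1 / 2)) (edge_point (snd s0) (1 / 2)) t)"])
      (simp add: linepath_def)
next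
  case (Suc n)
  then obtain \<gamma> where \<gamma>: "pathin (punctured_surface D) \<gamma>" "\<gamma> 0 = proj D (midpoint_rep s0)"
      "\<gamma> 1 = proj D (midpoint_rep ((next_corner ^^ n) s0))"
      "hol \<gamma> (midpoint_rep s0) (midpoint_rep ((next_corner ^^ n) s0)) =
        (- inverse zeta) ^ n * zeta ^ snd ((next_corner ^^ n) s0) / zeta ^ snd s0"
    by blast
  have "(next_corner ^^ n) s0 \<in> face_sides D"
    using s0 by (induction n) (auto intro: next_corner_closed)
  moreover obtain f i where fi: "(next_corner ^^ n) s0 = (f, i)" by fastforce
  ultimately have s: "(f, i) \<in> face_sides D" by simp
  obtain g j where gj: "partner D (f, i) = (g, j)" by fastforce
  have g: "g \<in> faces D" using partner_closed [OF s] gj by (simp add: mem_face_sides)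
  define j' where "j' = Suc j mod p"
  have next': "(next_corner ^^ Suc n) s0 = (g, j')"
    using s gj fi by (simp add: next_corner_def j'_def)
  define \<beta> where "\<beta> = (\<lambda>t. proj D (g, linepath (edge_point j (1 / 2)) (edge_point j' (1 / 2)) t))"
  have \<beta>: "pathin (punctured_surface D) \<beta>" "hol \<beta> (g, edge_point j (1 / 2)) (g, edge_point j' (1 / 2)) = 1"
    using hol_in_face [OF g path_linepath segment_between_midpoints [of j j']]
    by (simp_all add: \<beta>_def linepath_def)
  have glue: "gluing_map D (f, i) (edge_point i (1 / 2)) = edge_point j (1 / 2)"
    by (simp add: gluing_map_edge_point gj)
  have mid: "edge_point i (1 / 2) \<in> side D i" by (rule edge_point_in_side) simp
  have "((f, edge_point i (1 / 2)), (g, edge_point j (1 / 2))) \<in> glued D"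
    unfolding glued_def using s mid glue gj by force
  then have \<beta>0: "\<beta> 0 = proj D (f, edge_point i (1 / 2))"
    by (simp add: \<beta>_def linepath_def proj_glued)
  have \<beta>1: "\<beta> 1 = proj D (g, edge_point j' (1 / 2))"
    by (simp add: \<beta>_def linepath_def)
  have "hol \<beta> (f, edge_point i (1 / 2)) (g, edge_point j' (1 / 2)) = gluing_rot D (f, i)"
    using hol_glue_start [OF \<beta>(1) _ s _ mid, of "(g, edge_point j' (1 / 2))"] \<beta>(2)
    by (simp add: \<beta>0 \<beta>1 glue gj)
  moreover have eq: "\<gamma> 1 = \<beta> 0" using \<gamma>(3) \<beta>0 fi by simp
  ultimately have "hol (join_path \<gamma> \<beta>) (midpoint_rep s0) (g, edge_point j' (1 / 2)) =
      hol \<gamma> (midpoint_rep s0) (f, edge_point i (1 / 2)) * gluing_rot D (f, i)"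
    using hol_join_path [OF \<gamma>(1) \<beta>(1), of "midpoint_rep s0" "(f, edge_point i (1 / 2))"
      "(g, edge_point j' (1 / 2))"]
    by (simp add: \<gamma>(2) \<beta>0 \<beta>1)
  also have "\<dots> = (- inverse zeta) ^ n * (zeta ^ i / zeta ^ snd s0) * - (zeta ^ j / zeta ^ i)"
    using \<gamma>(4) by (simp add: fi gluing_rot_eq gj)
  \<comment> \<open>The step enters through side \<open>j\<close> but continues with side
    \<open>Suc j\<close>; this shift of one is the source of \<open>inverse zeta\<close>, and
    reduction modulo \<open>p\<close> does not affect powers of \<open>zeta\<close>.\<close>
  also have "\<dots> = (- inverse zeta) ^ Suc n * zeta ^ j' / zeta ^ snd s0"
    by (simp add: j'_def zeta_power_mod field_simps)
  finally show ?case
    using pathin_join_path [OF \<gamma>(1) \<beta>(1) eq]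
    by (intro exI [of _ "join_path \<gamma> \<beta>"]) (simp only: next' fst_conv snd_conv join_path_0 join_path_1 \<gamma>(2) \<beta>1 simp_thms)
qed

lemma holonomy_around_vertex:
  assumes sym: "has_schlafli_symbol D n q"
  obtains \<gamma> r where "pathin (punctured_surface D) \<gamma>" "\<gamma> 0 = \<gamma> 1" "r \<in> \<gamma> 0"
    "hol \<gamma> r r = cis (real q * (real n - 2) / real n * pi)"
proof -
  obtain f where "f \<in> faces D" using faces_nonempty by blast
  then have s0: "(f, 0) \<in> face_sides D" using p_ge_3 by (simp add: mem_face_sides)
  have n: "n = p" using sym by (simp add: has_schlafli_symbol_def)
  have "proj D (f, corner D 0) \<in> vertices D"
    unfolding vertices_def using s0 by force
  then have "vertex_degree D (proj D (f, corner D 0)) = q"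
    using sym by (simp add: has_schlafli_symbol_def)
  then have closed: "(next_corner ^^ q) (f, 0) = (f, 0)"
    using next_corner_vertex_degree [OF s0] by simp
  obtain \<gamma> where \<gamma>: "pathin (punctured_surface D) \<gamma>" "\<gamma> 0 = proj D (midpoint_rep (f, 0))"
      "\<gamma> 1 = proj D (midpoint_rep (f, 0))"
      "hol \<gamma> (midpoint_rep (f, 0)) (midpoint_rep (f, 0)) = (- inverse zeta) ^ q"
    using rotate_about_vertex [OF s0, of q] unfolding closed by auto
  \<comment> \<open>\<open>pi - 2 * pi / p\<close> is the interior angle of the regular
    \<open>p\<close>-gon, so the \<open>q\<close>-th power records the total angle at the
    vertex.\<close>
  have "- inverse zeta = cis (pi - 2 * pi / real p)"
    by (simp add: zeta_def cis_inverse flip: cis_divide) (simp add: inverse_eq_divide flip: cis_inverse)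
  then have "(- inverse zeta) ^ q = cis (real q * (pi - 2 * pi / real p))"
    by (simp add: Complex.DeMoivre)
  also have "real q * (pi - 2 * pi / real p) = real q * (real n - 2) / real n * pi"
    using p_ge_3 by (simp add: n field_simps)
  finally show thesis
    using \<gamma> by (intro that [of \<gamma> "midpoint_rep (f, 0)"]) simp_all
qed

end

section \<open>The fibres of the unfolding\<close>

lemma power_card_of_finite_mult_closed:
  fixes c :: "'a::field"
  assumes "finite H" "0 \<notin> H" "c \<in> H" and closed: "\<And>a b. a \<in> H \<Longrightarrow> b \<in> H \<Longrightarrow> a * b \<in> H"
  shows "c ^ card H = 1"
proof -
  have inj: "inj_on ((*) c) H"
    using assms by (auto intro!: inj_onI)
  have "(*) c ` H = H"
    using assms inj by (intro endo_inj_surj) auto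
  \<comment> \<open>Multiplication by \<open>c\<close> permutes \<open>H\<close>, so the product
    over \<open>H\<close> reappears with the factor \<open>c ^ card H\<close>; being nonzero, it
    cancels.\<close>
  then have "\<Prod>H = (\<Prod>a\<in>H. c * a)"
    using prod.reindex [OF inj, of "\<lambda>a. a"] by simp
  also have "\<dots> = c ^ card H * \<Prod>H"
    by (simp add: prod.distrib)
  finally show ?thesis using assms by simp
qed

text \<open>After division with remainder, \<open>w\<close> raised to the remainder is 1, so
  minimality leaves remainder 0.\<close>

lemma Least_power_eq_1_dvd:
  fixes w :: "'a::monoid_mult"
  assumes "n > 0" "w ^ n = 1"
  shows "(LEAST m. m > 0 \<and> w ^ m = 1) dvd n"
proof -
  define m where "m = (LEAST m. m > 0 \<and> w ^ m = 1)"
  have m: "m > 0" "w ^ m = 1"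
    using LeastI [of "\<lambda>m. m > 0 \<and> w ^ m = 1" n] assms by (auto simp: m_def)
  have "w ^ n = w ^ (m * (n div m) + n mod m)" by simp
  also have "\<dots> = w ^ (n mod m)" by (simp only: power_add power_mult m(2)) simp
  finally have "w ^ (n mod m) = 1" using assms by simp
  moreover have "n mod m < m" using m by simp
  ultimately have "n mod m = 0"
    using not_less_Least [of "n mod m" "\<lambda>m. m > 0 \<and> w ^ m = 1"] by (auto simp: m_def)
  then show ?thesis unfolding m_def [symmetric] by (simp add: dvd_eq_mod_eq_0)
qed

lemma rcong_2pi_iff_cis: "[x = 0] (rmod (2 * pi)) \<longleftrightarrow> cis x = 1"
proof -
  have "[x = 0] (rmod (2 * pi)) \<longleftrightarrow> [0 = x] (rmod (2 * pi))"
    by (rule rcong_sym_iff)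
  also have "\<dots> \<longleftrightarrow> (\<exists>n::int. x = of_int n * 2 * pi)"
    unfolding rcong_altdef by (simp add: mult_ac)
  also have "\<dots> \<longleftrightarrow> cis x = 1"
    using cos_one_2pi_int [of x] cos_one_sin_zero [of x] by (auto simp: complex_eq_iff)
  finally show ?thesis .
qed

lemma comp_join_path: "p \<circ> join_path g h = join_path (p \<circ> g) (p \<circ> h)"
  and comp_rev_path: "p \<circ> rev_path g = rev_path (p \<circ> g)"
  by (auto simp: join_path_def rev_path_def)

section \<open>Counting a fibre by holonomies\<close>

locale unfolding_of_surface = polygon_surface D
  for D :: "'f polygon_gluing" +
  fixes E :: "'e topology" and \<pi> :: "'e \<Rightarrow> ('f \<times> complex) set"
  assumes unfolds: "is_unfolding D E \<pi>"
begin

abbreviation "PC \<equiv> punctured_cover D E \<pi>"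
abbreviation "PS \<equiv> punctured_surface D"

definition holonomy_group :: "('f \<times> complex) set \<Rightarrow> 'f \<times> complex \<Rightarrow> complex set" where
  "holonomy_group x r = {hol \<gamma> r r | \<gamma>. closed_curve PS \<gamma> \<and> \<gamma> 0 = x}"

lemma covering: "covering_map PC PS \<pi>"
  using unfolds by (simp add: is_unfolding_def branched_cover_def)

lemma trivial_holonomy_iff_lifts:
  assumes "e \<in> topspace PC" "closed_curve PS \<gamma>" "\<gamma> 0 = \<pi> e"
  shows "trivial_holonomy D \<gamma> \<longleftrightarrow>
    (\<exists>\<delta>. closed_curve PC \<delta> \<and> \<delta> 0 = e \<and> (\<forall>t\<in>{0..1}. \<pi> (\<delta> t) = \<gamma> t))"
  using unfolds assms by (simp add: is_unfolding_def)

lemma pathin_projection: "pathin PC \<delta> \<Longrightarrow> pathin PS (\<pi> \<circ> \<delta>)"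
  using covering pathin_compose by (auto simp: covering_map_def)

text \<open>Points of a fibre must be joined by paths, while the unfolding is given as connected.
  Local path connectedness passes from the convex polygons to the quotient and from there to the
  cover.\<close>

lemma path_connected_cover: "path_connected_space PC"
proof -
  have "locally_path_connected_space PC"
    using covering_map_locally_path_connected_space [OF covering locally_path_connected_punctured_surface] .
  moreover have "connected_space PC"
    using unfolds unfolding is_unfolding_def by (elim conjE)
  ultimately show ?thesis by (simp only: path_connected_eq_connected_space)
qed

lemma fibre_nonempty:
  assumes "x \<in> topspace PS" obtains e where "e \<in> topspace PC" "\<pi> e = x"
proof -
  have "\<pi> ` topspace PC = topspace PS"
    by (rule conjunct1 [OF conjunct2 [OF covering [unfolded covering_map_def]]])
  then have "x \<in> \<pi> ` topspace PC" using assms by (simp only:)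
  then show thesis by (rule imageE) (rule that, simp_all only:)
qed

lemma path_connected_punctured_surface:
  assumes "x \<in> topspace PS" "y \<in> topspace PS"
  obtains \<alpha> where "pathin PS \<alpha>" "\<alpha> 0 = x" "\<alpha> 1 = y"
proof -
  obtain e where e: "e \<in> topspace PC" "\<pi> e = x" using fibre_nonempty [OF assms(1)] .
  obtain e' where e': "e' \<in> topspace PC" "\<pi> e' = y" using fibre_nonempty [OF assms(2)] .
  have "\<exists>\<delta>. pathin PC \<delta> \<and> \<delta> 0 = e \<and> \<delta> 1 = e'"
    using bspec [OF bspec [OF path_connected_cover [unfolded path_connected_space_def] e(1)] e'(1)] .
  then obtain \<delta> where \<delta>: "pathin PC \<delta>" "\<delta> 0 = e" "\<delta> 1 = e'"
    by (elim exE conjE)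
  show thesis
  proof (rule that)
    show "pathin PS (\<pi> \<circ> \<delta>)" by (rule pathin_projection [OF \<delta>(1)])
    show "(\<pi> \<circ> \<delta>) 0 = x" "(\<pi> \<circ> \<delta>) 1 = y" using \<delta>(2,3) e(2) e'(2) by simp_all
  qed
qed

lemma holonomy_groupI: "closed_curve PS \<gamma> \<Longrightarrow> \<gamma> 0 = x \<Longrightarrow> hol \<gamma> r r \<in> holonomy_group x r"
  by (auto simp: holonomy_group_def)

lemma holonomy_group_mult:
  assumes "r \<in> x" "a \<in> holonomy_group x r" "b \<in> holonomy_group x r"
  shows "a * b \<in> holonomy_group x r"
proof -
  obtain \<gamma> \<gamma>' where \<gamma>: "closed_curve PS \<gamma>" "\<gamma> 0 = x" "a = hol \<gamma> r r"
      and \<gamma>': "closed_curve PS \<gamma>'" "\<gamma>' 0 = x" "b = hol \<gamma>' r r"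
    using assms(2,3) by (auto simp: holonomy_group_def)
  have path: "pathin PS \<gamma>" "pathin PS \<gamma>'" "\<gamma> 1 = x" "\<gamma>' 1 = x"
    using \<gamma> \<gamma>' by (auto simp: closed_curve_def)
  have "a * b = hol (join_path \<gamma> \<gamma>') r r"
    using hol_join_path [OF path(1,2), of r r r] path \<gamma> \<gamma>' assms(1) by simp
  moreover have "closed_curve PS (join_path \<gamma> \<gamma>')"
    using pathin_join_path [OF path(1,2)] path \<gamma> \<gamma>' by (simp add: closed_curve_def)
  ultimately show ?thesis using holonomy_groupI [of "join_path \<gamma> \<gamma>'" x r] \<gamma> by simp
qed

text \<open>Change of base point: the loop around a vertex starts at a side midpoint, not at
  \<open>x\<close>. Transport along \<open>\<alpha>\<close> and back cancels because the
  coefficients commute.\<close>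

lemma holonomy_group_conjugate:
  assumes x: "x \<in> topspace PS" "r \<in> x" and \<gamma>: "closed_curve PS \<gamma>" and s: "s \<in> \<gamma> 0"
  shows "hol \<gamma> s s \<in> holonomy_group x r"
proof -
  have path: "pathin PS \<gamma>" "\<gamma> 1 = \<gamma> 0" using \<gamma> by (auto simp: closed_curve_def)
  then have "\<gamma> 0 \<in> topspace PS" using path_start_in_topspace by metis
  then obtain \<alpha> where \<alpha>: "pathin PS \<alpha>" "\<alpha> 0 = x" "\<alpha> 1 = \<gamma> 0"
    using path_connected_punctured_surface x(1) by metis
  define \<beta> where "\<beta> = join_path (join_path \<alpha> \<gamma>) (rev_path \<alpha>)"
  have 1: "pathin PS (join_path \<alpha> \<gamma>)" by (rule pathin_join_path) (use \<alpha> path in auto)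
  have 2: "pathin PS (rev_path \<alpha>)" by (rule pathin_rev_path) (use \<alpha> in auto)
  have "closed_curve PS \<beta>"
    unfolding closed_curve_def \<beta>_def using pathin_join_path [OF 1 2] \<alpha> path by simp
  moreover have "hol \<beta> r r = hol \<gamma> s s"
  proof -
    have nz: "hol \<alpha> r s \<noteq> 0" using norm_hol [OF \<alpha>(1), of r s] \<alpha> x s by auto
    have "hol \<beta> r r = hol \<alpha> r s * hol \<gamma> s s * hol (rev_path \<alpha>) s r"
      unfolding \<beta>_def
      using hol_join_path [OF 1 2, of r s r] hol_join_path [OF \<alpha>(1) path(1), of r s s] \<alpha> path x s by simp
    also have "hol (rev_path \<alpha>) s r = inverse (hol \<alpha> r s)"
      using hol_rev_path [OF \<alpha>(1), of r s] \<alpha> x s by simp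
    finally show ?thesis using nz by simp
  qed
  moreover have "\<beta> 0 = x" using \<alpha> by (simp add: \<beta>_def)
  ultimately show ?thesis using holonomy_groupI [of \<beta> x r] by simp
qed

text \<open>Going back along \<open>\<delta>1\<close> and out along \<open>\<delta>2\<close>
  projects to a closed curve at \<open>x\<close>. The defining property of the unfolding at
  \<open>\<delta>1 1\<close> relates closing up in the cover to trivial holonomy.\<close>

lemma lifts_end_together_iff:
  assumes d1: "pathin PC \<delta>1" "\<delta>1 0 = e0" and d2: "pathin PC \<delta>2" "\<delta>2 0 = e0"
    and x: "\<pi> e0 = x" "\<pi> (\<delta>1 1) = x" "\<pi> (\<delta>2 1) = x" "r \<in> x"
  shows "\<delta>1 1 = \<delta>2 1 \<longleftrightarrow> hol (\<pi> \<circ> \<delta>1) r r = hol (\<pi> \<circ> \<delta>2) r r"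
proof -
  note p1 = pathin_projection [OF d1(1)] and p2 = pathin_projection [OF d2(1)]
  have nz: "hol (\<pi> \<circ> \<delta>1) r r \<noteq> 0"
    using norm_hol [OF p1, of r r] x d1 by auto
  define \<gamma> where "\<gamma> = join_path (rev_path (\<pi> \<circ> \<delta>1)) (\<pi> \<circ> \<delta>2)"
  have path: "pathin PS \<gamma>"
    unfolding \<gamma>_def by (rule pathin_join_path [OF pathin_rev_path [OF p1] p2]) (use d1 d2 in simp)
  have ends: "\<gamma> 0 = x" "\<gamma> 1 = x" using x by (simp_all add: \<gamma>_def)
  have "hol \<gamma> r r = inverse (hol (\<pi> \<circ> \<delta>1) r r) * hol (\<pi> \<circ> \<delta>2) r r"
    unfolding \<gamma>_def
    using hol_join_path [OF pathin_rev_path [OF p1] p2, of r r r] hol_rev_path [OF p1, of r r] x d1 d2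
    by simp
  then have triv: "trivial_holonomy D \<gamma> \<longleftrightarrow> hol (\<pi> \<circ> \<delta>1) r r = hol (\<pi> \<circ> \<delta>2) r r"
    using trivial_holonomy_iff [OF path, of r] ends x nz by (auto simp: field_simps)
  define \<delta> where "\<delta> = join_path (rev_path \<delta>1) \<delta>2"
  have \<delta>: "pathin PC \<delta>" "\<pi> \<circ> \<delta> = \<gamma>"
    unfolding \<delta>_def \<gamma>_def comp_join_path comp_rev_path
    by (auto intro!: pathin_join_path pathin_rev_path d1 d2 simp: d1(2) d2(2))
  have top: "\<delta>1 1 \<in> topspace PC" using pathin_into_topspace [OF d1(1)] by simp
  have closed: "closed_curve PS \<gamma>" using path ends by (simp add: closed_curve_def)
  have "trivial_holonomy D \<gamma> \<longleftrightarrow> \<delta>1 1 = \<delta>2 1"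
  proof
    assume "trivial_holonomy D \<gamma>"
    then obtain \<delta>' where \<delta>': "closed_curve PC \<delta>'" "\<delta>' 0 = \<delta>1 1" "\<And>t. t \<in> {0..1} \<Longrightarrow> \<pi> (\<delta>' t) = \<gamma> t"
      using trivial_holonomy_iff_lifts [OF top closed] ends x by auto
    \<comment> \<open>The unfolding condition yields some closed lift; uniqueness of lifts
      identifies its end with that of \<open>\<delta>\<close>.\<close>
    have "\<delta> 1 = \<delta>' 1"
    proof (rule covering_map_lift_unique [OF covering \<delta>(1)])
      show "pathin PC \<delta>'" using \<delta>' by (simp add: closed_curve_def)
      show "\<pi> (\<delta> t) = \<pi> (\<delta>' t)" if "t \<in> {0..1}" for t
        using \<delta>'(3) [OF that] \<delta>(2) by (auto simp: fun_eq_iff)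
      show "\<delta> 0 = \<delta>' 0" using \<delta>' by (simp add: \<delta>_def)
    qed
    then show "\<delta>1 1 = \<delta>2 1" using \<delta>' by (simp add: \<delta>_def closed_curve_def)
  next
    assume "\<delta>1 1 = \<delta>2 1"
    then have "closed_curve PC \<delta>" "\<delta> 0 = \<delta>1 1"
      using \<delta>(1) by (simp_all add: closed_curve_def \<delta>_def)
    then show "trivial_holonomy D \<gamma>"
      using trivial_holonomy_iff_lifts [OF top closed] ends x \<delta>(2) by (auto simp: fun_eq_iff)
  qed
  then show ?thesis using triv by simp
qed

lemma card_fibre:
  assumes x: "x \<in> topspace PS" "r \<in> x"
  shows "card {e \<in> topspace E. \<pi> e = x} = card (holonomy_group x r)"
proof -
  \<comment> \<open>\<open>x\<close> is not a vertex, so removing the points over vertices leaves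
    its fibre intact.\<close>
  have fibre: "{e \<in> topspace E. \<pi> e = x} = {e \<in> topspace PC. \<pi> e = x}"
    using x(1) by (auto simp: punctured_cover_def topspace_punctured_surface)
  obtain e0 where e0: "e0 \<in> topspace PC" "\<pi> e0 = x" using fibre_nonempty [OF x(1)] .
  have "\<forall>e\<in>topspace PC. \<exists>\<delta>. pathin PC \<delta> \<and> \<delta> 0 = e0 \<and> \<delta> 1 = e"
    using path_connected_cover e0(1) unfolding path_connected_space_def by blast
  then obtain \<delta> where \<delta>: "\<And>e. e \<in> topspace PC \<Longrightarrow> pathin PC (\<delta> e) \<and> \<delta> e 0 = e0 \<and> \<delta> e 1 = e"
    by metis
  define h where "h e = hol (\<pi> \<circ> \<delta> e) r r" for e
  have "bij_betw h {e \<in> topspace PC. \<pi> e = x} (holonomy_group x r)"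
    unfolding bij_betw_def
  proof (intro conjI inj_onI equalityI subsetI)
    fix e e' assume e: "e \<in> {e \<in> topspace PC. \<pi> e = x}" "e' \<in> {e \<in> topspace PC. \<pi> e = x}" "h e = h e'"
    then show "e = e'"
      using lifts_end_together_iff [of "\<delta> e" e0 "\<delta> e'" x r] \<delta> [of e] \<delta> [of e'] e0 x(2)
      by (simp add: h_def)
  next
    fix c assume "c \<in> h ` {e \<in> topspace PC. \<pi> e = x}"
    then obtain e where e: "e \<in> topspace PC" "\<pi> e = x" "c = h e" by blast
    then have "closed_curve PS (\<pi> \<circ> \<delta> e)" "(\<pi> \<circ> \<delta> e) 0 = x"
      using pathin_projection \<delta> [of e] e0 by (auto simp: closed_curve_def)
    then show "c \<in> holonomy_group x r"
      unfolding e(3) h_def by (rule holonomy_groupI)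
  next
    fix c assume "c \<in> holonomy_group x r"
    then obtain \<gamma> where \<gamma>: "closed_curve PS \<gamma>" "\<gamma> 0 = x" "c = hol \<gamma> r r"
      by (auto simp: holonomy_group_def)
    then have path: "pathin PS \<gamma>" "\<gamma> 1 = x" by (auto simp: closed_curve_def)
    obtain d where d: "pathin PC d" "d 0 = e0" "\<And>t. t \<in> {0..1} \<Longrightarrow> \<pi> (d t) = \<gamma> t"
      using covering_map_lift [OF covering path(1) e0(1)] e0(2) \<gamma>(2) by metis
    define e where "e = d 1"
    have e: "e \<in> topspace PC" "\<pi> e = x"
      using pathin_into_topspace [OF d(1)] d(3) [of 1] path by (simp_all add: e_def)
    \<comment> \<open>The lift \<open>d\<close> need not be the chosen path
      \<open>\<delta> e\<close>, but both end at \<open>e\<close> and therefore have the same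
      holonomy.\<close>
    have "h e = hol (\<pi> \<circ> d) r r"
      using lifts_end_together_iff [of "\<delta> e" e0 d x r] \<delta> [OF e(1)] d e e0 x(2)
      by (simp add: h_def e_def)
    also have "\<dots> = c"
      unfolding \<gamma>(3) using path \<gamma> x(2) d
      by (intro hol_cong pathin_projection) auto
    finally show "c \<in> h ` {e \<in> topspace PC. \<pi> e = x}" using e by blast
  qed
  then show ?thesis unfolding fibre by (rule bij_betw_same_card)
qed

end

theorem proposition1p2:
  fixes D :: "'f polygon_gluing" and E :: "'e topology"
    and \<pi>\<^sub>D :: "'e \<Rightarrow> ('f \<times> complex) set"
    and p q k k' :: nat and x :: "('f \<times> complex) set"
  assumes "platonic_surface D"
    and "has_schlafli_symbol D p q"
    and "k' = (LEAST n. n > 0 \<and>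
           [real n * (real q * (real p - 2) / real p) * pi = 0] (rmod (2 * pi)))"
    and "is_unfolding D E \<pi>\<^sub>D"
    and "x \<in> topspace (punctured_surface D)"
    and "k = card {e \<in> topspace E. \<pi>\<^sub>D e = x}"
  shows "k' dvd k \<and> (even p \<longrightarrow> k' \<le> k \<and> k \<le> p) \<and> (odd p \<longrightarrow> k' \<le> k \<and> k \<le> 2 * p)"
proof -
  interpret unfolding_of_surface D E \<pi>\<^sub>D
    using assms(1,4) by unfold_locales (simp_all add: platonic_surface_def)
  have p: "p = sides_per_face D" using assms(2) by (simp add: has_schlafli_symbol_def)
  have p0: "p > 0" using p_ge_3 p by simp
  have "x \<in> topspace (surface D)" using assms(5) by (simp add: topspace_punctured_surface)
  from surface_point_nonempty [OF this] obtain r where r: "r \<in> x" by (rule exE)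
  define H where "H = holonomy_group x r"
  define w where "w = cis (real q * (real p - 2) / real p * pi)"
  have k: "k = card H" using card_fibre [OF assms(5) r] assms(6) by (simp add: H_def)
  have k': "k' = (LEAST n. n > 0 \<and> w ^ n = 1)"
    unfolding assms(3) rcong_2pi_iff_cis w_def Complex.DeMoivre by (simp add: mult.assoc)
  \<comment> \<open>The least positive even multiple of \<open>p\<close>.\<close>
  define N where "N = (if even p then p else 2 * p)"
  have N: "even N" "sides_per_face D dvd N" "N > 0" using p p0 by (auto simp: N_def)
  have sub: "H \<subseteq> {c. c ^ N = 1}"
    unfolding H_def holonomy_group_def closed_curve_def using hol_root_of_unity N r by blast
  have finH: "finite H" by (rule finite_subset [OF sub]) (use N in \<open>simp add: finite_roots_unity\<close>)
  have "k \<le> N"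
    using card_mono [OF _ sub] N card_roots_unity_eq [of N] by (simp add: k finite_roots_unity)
  have "w \<in> H"
    using holonomy_around_vertex [OF assms(2)] holonomy_group_conjugate [OF assms(5) r]
    unfolding H_def w_def closed_curve_def by metis
  moreover have "0 \<notin> H" using sub N by (auto simp: power_0_left)
  ultimately have "w ^ k = 1"
    unfolding k using finH holonomy_group_mult [OF r]
    by (intro power_card_of_finite_mult_closed) (auto simp: H_def)
  \<comment> \<open>\<open>card\<close> is 0 for infinite sets, so finiteness of \<open>H\<close>
    matters here besides \<open>w \<in> H\<close>.\<close>
  moreover have "k > 0" using \<open>w \<in> H\<close> finH by (auto simp: k card_gt_0_iff)
  ultimately have "k' dvd k" unfolding k' by (intro Least_power_eq_1_dvd)
  then show ?thesis
    using \<open>k > 0\<close> \<open>k \<le> N\<close> dvd_imp_le [of k' k] by (auto simp: N_def)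
qed

end
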